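(* Let $\mathbb{K}$ be a field of characteristic $0$ and let $\mathbb{F}$ be $\mathbb{K}[x]$ or $\mathbb{K}(x)$ with derivation $\partial/\partial x$. Let $p\in\mathbb{F}[y^{(\infty)}]$ and $q\in\mathbb{F}[z^{(\infty)}]$ be differential polynomials of order $n$ and $m$, respectively (not necessarily linear in their highest order terms). Then $$\mathfrak{o}_{\circ}(p,q)\;\le\; m+n+2,$$ where $\mathfrak{o}_\circ(p,q)$ is the minimal order of a non-zero differential polynomial in $w$ that can be derived from the dynamical model for the composition $w=y\circ z$ built from $p$ and $q$ (defined in the context).
   Context: Differential polynomials: $\mathbb{F}[y^{(\infty)}]=\mathbb{F}[y,y',y'',\ldots]$ is the polynomial ring in infinitely many variables $y^{(j)}$ ($j\in\mathbb{N}$, $y^{(0)}=y$) with the derivation extending that of $\mathbb{F}$ and satisfying $(y^{(j)})'=y^{(j+1)}$; similarly for several differential indeterminates. The order of a non-zero differential polynomial is the largest $n$ such that $y^{(n)}$ occurs in it. A differential polynomial $p$ of order $n$ is linear in its highest order term (l.h.o.) if $y^{(n)}$ appears only linearly in $p$, i.e. $p$ has degree $1$ in $y^{(n)}$. If $p$ is not l.h.o., its derivative $p'$ is l.h.o. and has order $n+1$. For a set $S$ of differential polynomials, $\langle S\rangle^{(\infty)}$ is the ideal generated by all elements of $S$ and all their derivatives. For an ideal $I$ of a ring $R$ and $s\in R$, $I:s^\infty=\{r\in R\mid \exists k\in\mathbb{N}: s^k r\in I\}$. Dynamical model: a system $\mathcal{M}$ of the form $u_i'=A_i(u_1,\ldots,u_N)$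 $(1\le i\le N)$, $w=B(u_1,\ldots,u_N)$, with $A_i,B\in\mathbb{K}(x)(u_1,\ldots,u_N)$. Let $Q$ be the common denominator of the system and write $A_i=a_i/Q$, $B=b/Q$ with $a_i,b,Q\in\mathbb{K}(x)[u_1,\ldots,u_N]$. Put $$I_{\mathcal{M}}=\langle Qu_1'-a_1,\ldots,Qu_N'-a_N,\;Qw-b\rangle^{(\infty)}:Q^\infty\;\subset\;\mathbb{K}(x)[u_1^{(\infty)},\ldots,u_N^{(\infty)},w^{(\infty)}].$$ The differential polynomials in $w$ derived from $\mathcal{M}$ are the elements of $I_{\mathcal{M}}\cap\mathbb{K}(x)[w^{(\infty)}]$. The model for composition built from $p$ and $q$: let $p_1=p$ if $p$ is l.h.o. and $p_1=p'$ otherwise (derivative in $\mathbb{F}[y^{(\infty)}]$, with $x'=1$); define $q_1$ from $q$ in the same way. Let $n_1,m_1$ be the orders of $p_1,q_1$. Solve $q_1=0$ for its highest order term: $z^{(m_1)}=r_{q}(x,z,\ldots,z^{(m_1-1)})$ with $r_q$ rational. Define $S_j$ recursively by $S_0=y$ and, if $S_j=\sum_{i=0}^j c_i y^{(i)}$ with $c_i\in\mathbb{K}[z^{(\infty)}]$, then $S_{j+1}=\sum_{i=0}^j\bigl(c_i'\,y^{(i)}+c_i\,z'\,y^{(i+1)}\bigr)$ (here $y^{(i)}$ stands for $f^{(i)}\circ g$ and $z$ for $g$, so that $S_j$ stands for $(f\circ g)^{(j)}$). Solving the triangular system $w^{(j)}=S_j$, $0\le j\le n_1$, for $y,\ldots,y^{(n_1)}$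 gives $y^{(k)}=a_k$ with $a_k\in\mathbb{K}(w,\ldots,w^{(k)},z,\ldots,z^{(k)})$ (with only powers of $z'$ in the denominators). In $p_1$, replace $x$ by $z$ and each $y^{(k)}$ by $a_k$. This gives a rational expression $R$ in which $w^{(n_1)}$ appears linearly. Solve $R=0$ for $w^{(n_1)}$ to get $w^{(n_1)}=r_p(z,\ldots,z^{(n_1)},w,\ldots,w^{(n_1-1)})$. If $m_1\le n_1$, all $z^{(j)}$ with $m_1\le j\le n_1$ are moreover rewritten in terms of $x,z,\ldots,z^{(m_1-1)}$ using $z^{(m_1)}=r_q$ and its derivatives. With $u_1=z,\ldots,u_{m_1}=z^{(m_1-1)}$, $u_{m_1+1}=w,\ldots,u_{m_1+n_1}=w^{(n_1-1)}$, the model is $$u_i'=u_{i+1}\ (1\le i\le m_1-1),\quad u_{m_1}'=r_q(x,u_1,\ldots,u_{m_1}),$$ $$u_{m_1+i}'=u_{m_1+i+1}\ (1\le i\le n_1-1),\quad u_{m_1+n_1}'=r_p(x,u_1,\ldots,u_{m_1+n_1}),$$ $$w=u_{m_1+1}.$$ (If $m_1=0$ there are no state variables for $z$, and $z=r_q(x)$; if $n_1=0$ there are no state variables for $w$, and the last equation is $w=r_p$. The construction presupposes that the denominators occurring, which are powers of $z'$, do not become $0$ after rewriting with $r_q$.) Finally, $\mathfrak{o}_\circ(p,q)$ is the minimal order of a non-zero element of $I_{\mathcal{M}}\cap\mathbb{K}(x)[w^{(\infty)}]$ for this model $\mathcal{M}$. *)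

theory Defs
  imports
    "HOL-Computational_Algebra.Computational_Algebra"
    "HOL-Library.Poly_Mapping"
    "HOL-Library.Extended_Nat"
begin

section \<open>Differential polynomials\<close>

text \<open>
  All differential polynomial rings are realised inside one ring, which has \<open>K(x)\<close> as
  coefficients and the differential indeterminates \<open>y\<close>, \<open>z\<close>, \<open>w\<close> and \<open>u\<^sub>1, u\<^sub>2, \<dots>\<close>.  The
  variable \<open>Deriv X j\<close> is the \<open>j\<close>-th derivative of the indeterminate \<open>X\<close>.
\<close>

datatype indet = Y | Z | W | U nat

datatype dvar = Deriv (indet_of: indet) (ord_of: nat)

text \<open>
  The linear order on the variables has no meaning of its own.  The library needs one to
  know that polynomials over an integral domain form an integral domain.
\<close>

primrec indet_code :: "indet \<Rightarrow> nat" where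
  "indet_code Y = 0"
| "indet_code Z = 1"
| "indet_code W = 2"
| "indet_code (U i) = i + 3"

lemma indet_code_inject: "indet_code a = indet_code b \<longleftrightarrow> a = b"
  by (cases a; cases b) auto

definition dvar_code :: "dvar \<Rightarrow> nat" where
  "dvar_code v = prod_encode (indet_code (indet_of v), ord_of v)"

lemma dvar_code_inject: "dvar_code a = dvar_code b \<longleftrightarrow> a = b"
  by (cases a; cases b) (auto simp: dvar_code_def indet_code_inject)

instantiation dvar :: linorder
begin

definition less_eq_dvar :: "dvar \<Rightarrow> dvar \<Rightarrow> bool" where
  "a \<le> b \<longleftrightarrow> dvar_code a \<le> dvar_code b"

definition less_dvar :: "dvar \<Rightarrow> dvar \<Rightarrow> bool" where
  "a < b \<longleftrightarrow> dvar_code a < dvar_code b"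

instance
  by standard (auto simp: less_eq_dvar_def less_dvar_def dvar_code_inject)

end

type_synonym 'k ratfun = "'k poly fract"
type_synonym 'k dpoly = "(dvar \<Rightarrow>\<^sub>0 nat) \<Rightarrow>\<^sub>0 'k ratfun"
type_synonym 'k drat = "'k dpoly fract"

definition const :: "'k::field_char_0 ratfun \<Rightarrow> 'k dpoly" where
  "const c = Poly_Mapping.single 0 c"

definition var :: "indet \<Rightarrow> nat \<Rightarrow> 'k::field_char_0 dpoly" where
  "var X j = Poly_Mapping.single (Poly_Mapping.single (Deriv X j) 1) 1"

abbreviation rvar :: "indet \<Rightarrow> nat \<Rightarrow> 'k::field_char_0 drat" where
  "rvar X j \<equiv> to_fract (var X j)"

definition vars :: "'k::field_char_0 dpoly \<Rightarrow> dvar set" where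
  "vars P = (\<Union>t\<in>Poly_Mapping.keys P. Poly_Mapping.keys t)"

definition polys_in :: "dvar set \<Rightarrow> 'k::field_char_0 dpoly set" where
  "polys_in V = {P. vars P \<subseteq> V}"

definition rats_in :: "dvar set \<Rightarrow> 'k::field_char_0 drat set" where
  "rats_in V = {Fract P Q | P Q. P \<in> polys_in V \<and> Q \<in> polys_in V \<and> Q \<noteq> 0}"

definition dvars_of :: "indet set \<Rightarrow> dvar set" where
  "dvars_of A = {Deriv X j | X j. X \<in> A}"

text \<open>For a subring \<open>F\<close> of \<open>K(x)\<close>: the differential polynomials over \<open>F\<close> in the
  indeterminates \<open>A\<close>.\<close>

definition dpolys_over :: "'k::field_char_0 ratfun set \<Rightarrow> indet set \<Rightarrow> 'k dpoly set" where
  "dpolys_over F A = {P \<in> polys_in (dvars_of A). \<forall>t. Poly_Mapping.lookup P t \<in> F}"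

text \<open>The order in the indeterminate \<open>X\<close>; meaningful only if some derivative of \<open>X\<close> occurs.\<close>

definition dorder :: "indet \<Rightarrow> 'k::field_char_0 dpoly \<Rightarrow> nat" where
  "dorder X P = Max {j. Deriv X j \<in> vars P}"

definition degree_in :: "dvar \<Rightarrow> 'k::field_char_0 dpoly \<Rightarrow> nat" where
  "degree_in v P = Max ((\<lambda>t. Poly_Mapping.lookup t v) ` Poly_Mapping.keys P)"

definition lho :: "indet \<Rightarrow> 'k::field_char_0 dpoly \<Rightarrow> bool" where
  "lho X P \<longleftrightarrow> degree_in (Deriv X (dorder X P)) P = 1"


section \<open>Derivations and substitutions\<close>

text \<open>
  \<open>quotient_rule d\<close> extends a derivation \<open>d\<close> from an integral domain to its fraction field.
  The values of \<open>d\<close> may lie in the fraction field.  The result does not depend on the chosen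
  representation of the fraction.
\<close>

definition quotient_rule :: "('a::idom \<Rightarrow> 'a fract) \<Rightarrow> 'a fract \<Rightarrow> 'a fract" where
  "quotient_rule d r =
     (let (a, b) = (SOME (a, b). b \<noteq> 0 \<and> r = Fract a b)
      in (d a * to_fract b - to_fract a * d b) / (to_fract b)\<^sup>2)"

text \<open>
  \<open>hom_fract h\<close> extends a ring homomorphism \<open>h\<close> from an integral domain into a field to those
  fractions that have a representation whose denominator \<open>h\<close> does not map to \<open>0\<close>; the value does
  not depend on the representation.  As for division by \<open>0\<close>, the remaining fractions are mapped
  to \<open>0\<close>.
\<close>

definition hom_fract :: "('a::idom \<Rightarrow> 'b::field) \<Rightarrow> 'a fract \<Rightarrow> 'b" where
  "hom_fract h r =
     (if \<exists>a b. h b \<noteq> 0 \<and> r = Fract a b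
      then SOME c. \<exists>a b. h b \<noteq> 0 \<and> r = Fract a b \<and> c = h a / h b
      else 0)"

definition ratfun_deriv :: "'k::field_char_0 ratfun \<Rightarrow> 'k ratfun" where
  "ratfun_deriv = quotient_rule (\<lambda>a. to_fract (pderiv a))"

definition partial_deriv :: "dvar \<Rightarrow> 'k::field_char_0 dpoly \<Rightarrow> 'k dpoly" where
  "partial_deriv v P =
     (\<Sum>t\<in>Poly_Mapping.keys P.
        Poly_Mapping.single (t - Poly_Mapping.single v 1)
          (of_nat (Poly_Mapping.lookup t v) * Poly_Mapping.lookup P t))"

definition coeff_deriv :: "'k::field_char_0 dpoly \<Rightarrow> 'k dpoly" where
  "coeff_deriv P = Poly_Mapping.map ratfun_deriv P"

text \<open>The derivation of the differential polynomial ring.\<close>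

definition dderiv :: "'k::field_char_0 dpoly \<Rightarrow> 'k dpoly" where
  "dderiv P = coeff_deriv P +
     (\<Sum>v\<in>vars P. partial_deriv v P * var (indet_of v) (Suc (ord_of v)))"

text \<open>The derivation of the field of rational functions that extends the one of \<open>K(x)\<close> and
  maps each variable \<open>v\<close> to \<open>\<delta> v\<close>.\<close>

definition field_deriv :: "(dvar \<Rightarrow> 'k::field_char_0 drat) \<Rightarrow> 'k drat \<Rightarrow> 'k drat" where
  "field_deriv \<delta> = quotient_rule
     (\<lambda>P. to_fract (coeff_deriv P) + (\<Sum>v\<in>vars P. to_fract (partial_deriv v P) * \<delta> v))"

text \<open>Replace each coefficient \<open>c\<close> by \<open>\<kappa> c\<close> and each variable \<open>v\<close> by \<open>\<sigma> v\<close>.\<close>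

definition subst_poly ::
  "('k::field_char_0 ratfun \<Rightarrow> 'k drat) \<Rightarrow> (dvar \<Rightarrow> 'k drat) \<Rightarrow> 'k dpoly \<Rightarrow> 'k drat" where
  "subst_poly \<kappa> \<sigma> P =
     (\<Sum>t\<in>Poly_Mapping.keys P. \<kappa> (Poly_Mapping.lookup P t) *
        (\<Prod>v\<in>Poly_Mapping.keys t. \<sigma> v ^ Poly_Mapping.lookup t v))"

definition subst_vars :: "(dvar \<Rightarrow> 'k::field_char_0 drat) \<Rightarrow> 'k drat \<Rightarrow> 'k drat" where
  "subst_vars \<sigma> = hom_fract (subst_poly (\<lambda>c. to_fract (const c)) \<sigma>)"

text \<open>\<open>eval_x s c\<close> is \<open>c(s)\<close>, that is, \<open>c \<in> K(x)\<close> with \<open>x\<close> replaced by \<open>s\<close>.\<close>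

definition eval_x :: "'k::field_char_0 drat \<Rightarrow> 'k ratfun \<Rightarrow> 'k drat" where
  "eval_x s = hom_fract
     (\<lambda>a. poly (map_poly (\<lambda>e. to_fract (const (to_fract [:e:]))) a) s)"

text \<open>The solution \<open>r\<close> for the variable \<open>X\<^sup>(\<^sup>j\<^sup>)\<close> of an equation \<open>R = 0\<close> in which this variable
  appears linearly.\<close>

definition solve_for :: "indet \<Rightarrow> nat \<Rightarrow> 'k::field_char_0 drat \<Rightarrow> 'k drat" where
  "solve_for X j R =
     (THE r. r \<in> rats_in (- {Deriv X j}) \<and>
        (\<exists>A \<in> rats_in (- {Deriv X j}). A \<noteq> 0 \<and> R = A * (rvar X j - r)))"


section \<open>Dynamical models and the polynomials derived from them\<close>

text \<open>
  \<open>Model N A B\<close> is the system \<open>u\<^sub>i' = A i\<close> for \<open>1 \<le> i \<le> N\<close>, \<open>w = B\<close>.  In \<open>A i\<close> and \<open>B\<close> the state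
  \<open>u\<^sub>i\<close> is the variable \<open>Deriv (U i) 0\<close>.
\<close>

datatype 'f model = Model (states: nat) (rhs: "nat \<Rightarrow> 'f") (observed: 'f)

definition state_vars :: "nat \<Rightarrow> dvar set" where
  "state_vars N = {Deriv (U i) 0 | i. 1 \<le> i \<and> i \<le> N}"

definition common_denominator ::
  "'k::field_char_0 drat model \<Rightarrow> 'k dpoly \<Rightarrow> (nat \<Rightarrow> 'k dpoly) \<Rightarrow> 'k dpoly \<Rightarrow> bool" where
  "common_denominator M Q a b \<longleftrightarrow>
     Q \<in> polys_in (state_vars (states M)) \<and> Q \<noteq> 0 \<and>
     (\<forall>i\<in>{1..states M}. a i \<in> polys_in (state_vars (states M)) \<and> rhs M i = Fract (a i) Q) \<and>
     b \<in> polys_in (state_vars (states M)) \<and> observed M = Fract b Q"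

definition ideal_generated :: "'a::comm_ring_1 set \<Rightarrow> 'a set \<Rightarrow> 'a set" where
  "ideal_generated R S =
     {\<Sum>g\<in>T. c g * g | T c. finite T \<and> T \<subseteq> S \<and> (\<forall>g\<in>T. c g \<in> R)}"

definition diff_ideal_generated ::
  "'k::field_char_0 dpoly set \<Rightarrow> 'k dpoly set \<Rightarrow> 'k dpoly set" where
  "diff_ideal_generated R S = ideal_generated R {(dderiv ^^ k) g | k g. g \<in> S}"

definition saturation :: "'a::comm_ring_1 set \<Rightarrow> 'a set \<Rightarrow> 'a \<Rightarrow> 'a set" where
  "saturation R I s = {r \<in> R. \<exists>k::nat. s ^ k * r \<in> I}"

definition model_ring :: "nat \<Rightarrow> 'k::field_char_0 dpoly set" where
  "model_ring N = polys_in (dvars_of (insert W (U ` {1..N})))"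

text \<open>The ideal does not depend on which common denominator is chosen.\<close>

definition model_ideal :: "'k::field_char_0 drat model \<Rightarrow> 'k dpoly set" where
  "model_ideal M =
     (let R = model_ring (states M);
          (Q, a, b) = (SOME (Q, a, b). common_denominator M Q a b)
      in saturation R
           (diff_ideal_generated R
              (insert (Q * var W 0 - b) ((\<lambda>i. Q * var (U i) 1 - a i) ` {1..states M})))
           Q)"

text \<open>The minimal order of a non-zero differential polynomial in \<open>w\<close> derived from the model; it
  is \<open>\<infinity>\<close> if there is none.\<close>

definition min_order :: "'k::field_char_0 drat model \<Rightarrow> enat" where
  "min_order M =
     (INF P \<in> {P \<in> model_ideal M \<inter> polys_in (dvars_of {W}). P \<noteq> 0}. enat (dorder W P))"


section \<open>The model for the composition\<close>

definition lho_form :: "indet \<Rightarrow> 'k::field_char_0 dpoly \<Rightarrow> 'k dpoly" where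
  "lho_form X P = (if lho X P then P else dderiv P)"

text \<open>\<open>chain_coeff j i\<close> is the coefficient \<open>c\<^sub>i\<close> of \<open>y\<^sup>(\<^sup>i\<^sup>)\<close> in \<open>S\<^sub>j\<close>.\<close>

fun chain_coeff :: "nat \<Rightarrow> nat \<Rightarrow> 'k::field_char_0 dpoly" where
  "chain_coeff 0 i = (if i = 0 then 1 else 0)"
| "chain_coeff (Suc j) 0 = dderiv (chain_coeff j 0)"
| "chain_coeff (Suc j) (Suc i) = dderiv (chain_coeff j (Suc i)) + chain_coeff j i * var Z 1"

text \<open>
  \<open>outer_deriv k\<close> is \<open>a\<^sub>k\<close>, obtained from \<open>w\<^sup>(\<^sup>j\<^sup>) = S\<^sub>j\<close> by forward substitution.  The diagonal
  entry \<open>chain_coeff k k\<close> is the \<open>k\<close>-th power of \<open>z'\<close>.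
\<close>

fun outer_deriv :: "nat \<Rightarrow> 'k::field_char_0 drat" where
  "outer_deriv k =
     (rvar W k - (\<Sum>i<k. to_fract (chain_coeff k i) * outer_deriv i))
       / to_fract (chain_coeff k k)"

declare outer_deriv.simps [simp del]

definition inner_order :: "'k::field_char_0 dpoly \<Rightarrow> nat" where
  "inner_order q = dorder Z (lho_form Z q)"

definition outer_order :: "'k::field_char_0 dpoly \<Rightarrow> nat" where
  "outer_order p = dorder Y (lho_form Y p)"

definition inner_rhs :: "'k::field_char_0 dpoly \<Rightarrow> 'k drat" where
  "inner_rhs q = solve_for Z (inner_order q) (to_fract (lho_form Z q))"

text \<open>\<open>r\<^sub>p\<close> before the high derivatives of \<open>z\<close> are rewritten.\<close>

definition outer_rhs :: "'k::field_char_0 dpoly \<Rightarrow> 'k drat" where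
  "outer_rhs p = solve_for W (outer_order p)
     (subst_poly (eval_x (rvar Z 0))
        (\<lambda>v. case v of Deriv Y k \<Rightarrow> outer_deriv k | _ \<Rightarrow> 0) (lho_form Y p))"

text \<open>
  \<open>reduced_z q j\<close> is \<open>z\<^sup>(\<^sup>j\<^sup>)\<close> in terms of \<open>x, z, \<dots>, z\<^sup>(\<^sup>m\<^sup>-\<^sup>1\<^sup>)\<close>, where \<open>m = inner_order q\<close>.
\<close>

definition reduced_z :: "'k::field_char_0 dpoly \<Rightarrow> nat \<Rightarrow> 'k drat" where
  "reduced_z q j =
     (let m = inner_order q;
          \<delta> = (\<lambda>v. case v of
                  Deriv Z i \<Rightarrow> if Suc i < m then rvar Z (Suc i) else inner_rhs q
                | _ \<Rightarrow> 0)
      in if j < m then rvar Z j else (field_deriv \<delta> ^^ (j - m)) (inner_rhs q))"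

definition reduce_z :: "'k::field_char_0 dpoly \<Rightarrow> 'k drat \<Rightarrow> 'k drat" where
  "reduce_z q = subst_vars
     (\<lambda>v. case v of Deriv Z j \<Rightarrow> reduced_z q j | Deriv X j \<Rightarrow> rvar X j)"

text \<open>Name \<open>z, \<dots>, z\<^sup>(\<^sup>m\<^sup>-\<^sup>1\<^sup>), w, \<dots>, w\<^sup>(\<^sup>n\<^sup>-\<^sup>1\<^sup>)\<close> as the states \<open>u\<^sub>1, \<dots>, u\<^sub>m\<^sub>+\<^sub>n\<close>; no other variables
  occur where this is applied.\<close>

definition to_states :: "nat \<Rightarrow> nat \<Rightarrow> 'k::field_char_0 drat \<Rightarrow> 'k drat" where
  "to_states m n = subst_vars
     (\<lambda>v. case v of
        Deriv Z j \<Rightarrow> if j < m then rvar (U (j + 1)) 0 else 0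
      | Deriv W j \<Rightarrow> if j < n then rvar (U (m + 1 + j)) 0 else 0
      | _ \<Rightarrow> 0)"

definition composition_model :: "'k::field_char_0 dpoly \<Rightarrow> 'k dpoly \<Rightarrow> 'k drat model" where
  "composition_model p q =
     (let m = inner_order q;
          n = outer_order p;
          rq = to_states m n (inner_rhs q);
          rp = to_states m n (reduce_z q (outer_rhs p))
      in Model (m + n)
           (\<lambda>i. if i = m + n \<and> 0 < n then rp
                else if i = m then rq
                else rvar (U (i + 1)) 0)
           (if n = 0 then rp else rvar (U (m + 1)) 0))"

text \<open>
  The construction divides by powers of \<open>z'\<close> up to the exponent \<open>outer_order p\<close>; these must not
  become \<open>0\<close> when \<open>z'\<close> is rewritten.  Then no other denominator becomes \<open>0\<close> either, except that
  a constant \<open>z \<in> K\<close> may be a pole of \<open>r\<^sub>p\<close> if both orders are \<open>0\<close>; in that case \<open>hom_fract\<close> gives \<open>0\<close>.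
\<close>

definition composition_admissible :: "'k::field_char_0 dpoly \<Rightarrow> 'k dpoly \<Rightarrow> bool" where
  "composition_admissible p q \<longleftrightarrow> (\<forall>k \<le> outer_order p. reduced_z q 1 ^ k \<noteq> 0)"

definition composition_order :: "'k::field_char_0 dpoly \<Rightarrow> 'k dpoly \<Rightarrow> enat" where
  "composition_order p q = min_order (composition_model p q)"

end

theory Submission
  imports Defs
begin

text \<open>
  The bound holds because the model has at most \<open>(m + 1) + (n + 1)\<close> states, and every model with
  \<open>N\<close> states has a non-zero elimination polynomial in \<open>w\<close> of order at most \<open>N\<close>: modulo the
  model ideal, each of \<open>w, w', \<dots>, w\<^sup>(\<^sup>N\<^sup>)\<close> becomes, after multiplication by a power of the common
  denominator \<open>Q\<close>, a polynomial in the \<open>N\<close> states.  These \<open>N + 1\<close> fractions are algebraically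
  dependent, and a power of \<open>Q\<close> times their relation evaluated at \<open>w, \<dots>, w\<^sup>(\<^sup>N\<^sup>)\<close> lies in the ideal.
\<close>

section \<open>The derivation of the differential polynomial ring\<close>

text \<open>Each summand 1 comes from passing to \<open>lho_form\<close>: a polynomial that is not
  linear in its highest derivative is replaced by its own derivative. As \<open>dorder\<close> is
  the maximum of a set, the bound on the new order also needs that the derivative is not free of
  variables; this rests on the partial derivative by the highest variable, which is non-zero in
  characteristic 0. The dependence is found by counting. With exponents up to \<open>d\<close>, more
  variables give more monomials, of order d^(N+1), than there are coefficients in the state
  polynomials that they become, of order d^N. The resulting relation is a polynomial identity
  without division and can therefore be compared term by term with its counterpart in w modulo the
  ideal. A relation without any variable has no meaningful order. It would put a power of
  \<open>Q\<close> into the ideal, so that the saturation is the whole ring and w itself can be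
  taken.\<close>

lemma quotient_rule_Fract:
  fixes d :: "'a::idom \<Rightarrow> 'a fract"
  assumes mult: "\<And>a b. d (a * b) = d a * to_fract b + to_fract a * d b"
    and "b \<noteq> 0"
  shows "quotient_rule d (Fract a b) = (d a * to_fract b - to_fract a * d b) / (to_fract b)\<^sup>2"
proof -
  define s where "s = (SOME (a', b'). b' \<noteq> 0 \<and> Fract a b = Fract a' b')"
  obtain a' b' where s: "s = (a', b')" by (cases s)
  have "case s of (a', b') \<Rightarrow> b' \<noteq> 0 \<and> Fract a b = Fract a' b'"
    unfolding s_def by (rule someI[of _ "(a, b)"]) (use assms in auto)
  then have b': "b' \<noteq> 0" and eq: "a * b' = a' * b"
    using \<open>b \<noteq> 0\<close> by (auto simp: s eq_fract)
  define A B A' B' where "A = to_fract a" and "B = to_fract b"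
    and "A' = to_fract a'" and "B' = to_fract b'"
  have nz: "B \<noteq> 0" "B' \<noteq> 0" using b' \<open>b \<noteq> 0\<close> by (auto simp: B_def B'_def)
  have e1: "A * B' = A' * B"
    using arg_cong[OF eq, of to_fract] by (simp add: A_def B_def A'_def B'_def)
  \<comment> \<open>Applying \<open>d\<close> to the equation between two representations of one
    fraction is what makes the quotient rule independent of the choice.\<close>
  have e2: "d a * B' + A * d b' = d a' * B + A' * d b"
    using arg_cong[OF eq, of d] by (simp add: mult A_def B_def A'_def B'_def)
  have "(d a' * B' - A' * d b') * B\<^sup>2 = (d a * B - A * d b) * B'\<^sup>2"
    using e1 e2 by algebra
  then have "(d a' * B' - A' * d b') / B'\<^sup>2 = (d a * B - A * d b) / B\<^sup>2"
    using nz by (simp add: frac_eq_eq)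
  then show ?thesis
    unfolding quotient_rule_def s_def[symmetric] by (simp add: s A_def B_def A'_def B'_def)
qed

lemma ratfun_deriv_Fract:
  "b \<noteq> 0 \<Longrightarrow> ratfun_deriv (Fract a b) =
    (to_fract (pderiv a) * to_fract b - to_fract a * to_fract (pderiv b)) / (to_fract b)\<^sup>2"
  unfolding ratfun_deriv_def
  by (rule quotient_rule_Fract) (simp_all add: pderiv_mult algebra_simps)

lemma ratfun_deriv_0: "ratfun_deriv 0 = 0"
  using ratfun_deriv_Fract[of 1 0] by (simp add: Zero_fract_def[symmetric])

lemma ratfun_deriv_add: "ratfun_deriv (r + s) = ratfun_deriv r + ratfun_deriv s"
proof (cases r; cases s)
  fix a b c e assume r: "r = Fract a b" "b \<noteq> 0" and s: "s = Fract c e" "e \<noteq> 0"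
  \<comment> \<open>The derivatives are free symbols here, which turns the sum rule into a plain
    identity in a field.\<close>
  have quotient: "((a' * e + a * e' + (c' * b + c * b')) * (b * e)
        - (a * e + c * b) * (b' * e + b * e')) / (b * e)\<^sup>2
      = (a' * b - a * b') / b\<^sup>2 + (c' * e - c * e') / e\<^sup>2"
    if "b \<noteq> 0" "e \<noteq> 0" for a a' b b' c c' e e' :: "'a ratfun"
    using that by (simp add: field_simps power2_eq_square)
  have "r + s = Fract (a * e + c * b) (b * e)" using r s by simp
  then have "ratfun_deriv (r + s) = (to_fract (pderiv (a * e + c * b)) * to_fract (b * e)
      - to_fract (a * e + c * b) * to_fract (pderiv (b * e))) / (to_fract (b * e))\<^sup>2"
    using r s by (simp add: ratfun_deriv_Fract del: to_fract_mult to_fract_add)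
  also have "\<dots> = ratfun_deriv r + ratfun_deriv s"
    using r s quotient[of "to_fract b" "to_fract e" "to_fract (pderiv a)" "to_fract a"
        "to_fract (pderiv e)" "to_fract (pderiv c)" "to_fract c" "to_fract (pderiv b)"]
    by (simp only: ratfun_deriv_Fract to_fract_eq_0_iff pderiv_mult pderiv_add to_fract_mult
        to_fract_add not_False_eq_True) (simp add: ac_simps)
  finally show ?thesis .
qed

lemma ratfun_deriv_mult: "ratfun_deriv (r * s) = ratfun_deriv r * s + r * ratfun_deriv s"
proof (cases r; cases s)
  fix a b c e assume r: "r = Fract a b" "b \<noteq> 0" and s: "s = Fract c e" "e \<noteq> 0"
  have quotient: "((a' * c + a * c') * (b * e) - a * c * (b' * e + b * e')) / (b * e)\<^sup>2
      = (a' * b - a * b') / b\<^sup>2 * (c / e) + a / b * ((c' * e - c * e') / e\<^sup>2)"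
    if "b \<noteq> 0" "e \<noteq> 0" for a a' b b' c c' e e' :: "'a ratfun"
    using that by (simp add: field_simps power2_eq_square)
  have "ratfun_deriv (r * s) = (to_fract (pderiv (a * c)) * to_fract (b * e)
      - to_fract (a * c) * to_fract (pderiv (b * e))) / (to_fract (b * e))\<^sup>2"
    using r s by (simp add: ratfun_deriv_Fract del: to_fract_mult)
  also have "\<dots> = ratfun_deriv r * s + r * ratfun_deriv s"
    using r s quotient[of "to_fract b" "to_fract e" "to_fract (pderiv a)" "to_fract c"
        "to_fract a" "to_fract (pderiv c)" "to_fract (pderiv b)" "to_fract (pderiv e)"]
    by (simp only: ratfun_deriv_Fract to_fract_eq_0_iff pderiv_mult to_fract_mult to_fract_add
        not_False_eq_True) (simp add: Fract_conv_to_fract ac_simps)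
  finally show ?thesis .
qed

section \<open>Sum and product rules in the polynomial ring\<close>

lemma poly_mapping_sum_single:
  "P = (\<Sum>t\<in>Poly_Mapping.keys P. Poly_Mapping.single t (Poly_Mapping.lookup P t))"
  by (rule poly_mapping_eqI)
    (auto simp: lookup_sum lookup_single when_def in_keys_iff sum.delta)

lemma poly_mapping_mult_conv_sum:
  fixes P Q :: "'a::monoid_add \<Rightarrow>\<^sub>0 'b::semiring_0"
  shows "P * Q = (\<Sum>s\<in>Poly_Mapping.keys P. \<Sum>t\<in>Poly_Mapping.keys Q.
    Poly_Mapping.single (s + t) (Poly_Mapping.lookup P s * Poly_Mapping.lookup Q t))"
  by (subst poly_mapping_sum_single[of P], subst poly_mapping_sum_single[of Q])
    (simp add: sum_product mult_single)

lemma additive_sum: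
  fixes D :: "'a::comm_monoid_add \<Rightarrow> 'b::ab_group_add"
  assumes "\<And>x y. D (x + y) = D x + D y"
  shows "D (sum f A) = (\<Sum>a\<in>A. D (f a))"
proof -
  have "D 0 = 0" using assms[of 0 0] by simp
  then show ?thesis by (induction A rule: infinite_finite_induct) (auto simp: assms)
qed

lemma additive_diff:
  fixes D :: "'a::ab_group_add \<Rightarrow> 'b::ab_group_add"
  assumes "\<And>x y. D (x + y) = D x + D y"
  shows "D (x - y) = D x - D y"
  using assms[of "x - y" y] by (simp add: eq_diff_eq)

lemma Leibniz_power:
  fixes D :: "'a::comm_ring_1 \<Rightarrow> 'a"
  assumes "\<And>x y. D (x * y) = D x * y + x * D y"
  shows "D (x ^ Suc k) = of_nat (Suc k) * x ^ k * D x"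
proof (induction k)
  case (Suc k)
  have "D (x ^ Suc (Suc k)) = D x * x ^ Suc k + x * D (x ^ Suc k)"
    by (subst power_Suc) (rule assms)
  then show ?case unfolding Suc by (simp add: algebra_simps)
qed simp

text \<open>Both sides are additive in \<open>P\<close> and in \<open>Q\<close>, so the product rule
  only has to be checked on single terms.\<close>

lemma Leibniz_from_single:
  fixes D :: "('a::monoid_add \<Rightarrow>\<^sub>0 'b::ring_1) \<Rightarrow> ('a \<Rightarrow>\<^sub>0 'b)"
  assumes add: "\<And>P Q. D (P + Q) = D P + D Q"
    and single: "\<And>s t a b. D (Poly_Mapping.single (s + t) (a * b)) =
      D (Poly_Mapping.single s a) * Poly_Mapping.single t b
      + Poly_Mapping.single s a * D (Poly_Mapping.single t b)"
  shows "D (P * Q) = D P * Q + P * D Q"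
proof -
  let ?S = "\<lambda>P t. Poly_Mapping.single t (Poly_Mapping.lookup P t)"
  have DP: "D P = (\<Sum>t\<in>Poly_Mapping.keys P. D (?S P t))" for P
    using additive_sum[where D = D, OF add] poly_mapping_sum_single[of P] by metis
  have "D (P * Q) = (\<Sum>s\<in>Poly_Mapping.keys P. \<Sum>t\<in>Poly_Mapping.keys Q.
      D (?S P s) * ?S Q t + ?S P s * D (?S Q t))"
    by (subst poly_mapping_mult_conv_sum) (simp only: additive_sum[where D = D, OF add] single)
  also have "\<dots> = (\<Sum>s\<in>Poly_Mapping.keys P. D (?S P s)) * (\<Sum>t\<in>Poly_Mapping.keys Q. ?S Q t)
      + (\<Sum>s\<in>Poly_Mapping.keys P. ?S P s) * (\<Sum>t\<in>Poly_Mapping.keys Q. D (?S Q t))"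
    by (simp only: sum_product sum.distrib)
  finally show ?thesis
    unfolding poly_mapping_sum_single[symmetric] DP[symmetric] .
qed

lemma lookup_coeff_deriv:
  "Poly_Mapping.lookup (coeff_deriv P) t = ratfun_deriv (Poly_Mapping.lookup P t)"
  by (simp add: coeff_deriv_def Poly_Mapping.map.rep_eq when_def ratfun_deriv_0)

lemma coeff_deriv_add: "coeff_deriv (P + Q) = coeff_deriv P + coeff_deriv Q"
  by (rule poly_mapping_eqI) (simp add: lookup_coeff_deriv lookup_add ratfun_deriv_add)

lemma coeff_deriv_single:
  "coeff_deriv (Poly_Mapping.single t c) = Poly_Mapping.single t (ratfun_deriv c)"
  by (rule poly_mapping_eqI)
    (simp add: lookup_coeff_deriv lookup_single when_def ratfun_deriv_0)

lemma coeff_deriv_mult: "coeff_deriv (P * Q) = coeff_deriv P * Q + P * coeff_deriv Q"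
  by (rule Leibniz_from_single)
    (simp_all add: coeff_deriv_add coeff_deriv_single mult_single ratfun_deriv_mult single_add)

lemma partial_deriv_superset:
  assumes "finite T" "Poly_Mapping.keys P \<subseteq> T"
  shows "partial_deriv v P = (\<Sum>t\<in>T. Poly_Mapping.single (t - Poly_Mapping.single v 1)
    (of_nat (Poly_Mapping.lookup t v) * Poly_Mapping.lookup P t))"
  unfolding partial_deriv_def
  by (rule sum.mono_neutral_left) (use assms in \<open>auto simp: in_keys_iff\<close>)

lemma partial_deriv_single:
  "partial_deriv v (Poly_Mapping.single t c) =
    Poly_Mapping.single (t - Poly_Mapping.single v 1) (of_nat (Poly_Mapping.lookup t v) * c)"
  by (simp add: partial_deriv_superset[where T = "{t}"])

lemma partial_deriv_add: "partial_deriv v (P + Q) = partial_deriv v P + partial_deriv v Q"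
proof -
  let ?T = "Poly_Mapping.keys P \<union> Poly_Mapping.keys Q"
  have "finite ?T" by simp
  then show ?thesis
    by (simp add: partial_deriv_superset[where T = ?T] keys_add lookup_add ring_distribs single_add
        sum.distrib)
qed

lemma partial_deriv_mult: "partial_deriv v (P * Q) = partial_deriv v P * Q + P * partial_deriv v Q"
proof (rule Leibniz_from_single)
  fix s t :: "dvar \<Rightarrow>\<^sub>0 nat" and a b :: "'a ratfun"
  let ?e = "Poly_Mapping.single v (1::nat)"
  \<comment> \<open>Subtraction of exponents is truncated at 0, so it can be moved past a sum only
    if \<open>v\<close> occurs in the first summand. Otherwise the coefficient, which carries the
    exponent of \<open>v\<close>, is 0.\<close>
  have shift [simplified]: "r + r' - ?e = (r - ?e) + r'" if "Poly_Mapping.lookup r v \<noteq> 0" for r r' :: "dvar \<Rightarrow>\<^sub>0 nat"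
    by (rule poly_mapping_eqI) (use that in \<open>auto simp: lookup_minus lookup_add lookup_single when_def\<close>)
  have s: "Poly_Mapping.single (s + t - ?e) (of_nat (Poly_Mapping.lookup s v) * (a * b))
      = Poly_Mapping.single (s - ?e + t) (of_nat (Poly_Mapping.lookup s v) * (a * b))"
    by (cases "Poly_Mapping.lookup s v = 0") (simp_all add: shift)
  have t: "Poly_Mapping.single (s + t - ?e) (of_nat (Poly_Mapping.lookup t v) * (a * b))
      = Poly_Mapping.single (s + (t - ?e)) (of_nat (Poly_Mapping.lookup t v) * (a * b))"
    using shift[of t s] by (cases "Poly_Mapping.lookup t v = 0") (simp_all add: add.commute)
  show "partial_deriv v (Poly_Mapping.single (s + t) (a * b)) =
      partial_deriv v (Poly_Mapping.single s a) * Poly_Mapping.single t b +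
      Poly_Mapping.single s a * partial_deriv v (Poly_Mapping.single t b)"
    unfolding partial_deriv_single mult_single lookup_add of_nat_add distrib_right single_add s t
    by (simp add: mult_ac)
qed (rule partial_deriv_add)

lemma finite_vars [simp]: "finite (vars P)"
  by (simp add: vars_def)

lemma partial_deriv_eq_0:
  assumes "v \<notin> vars P"
  shows "partial_deriv v P = 0"
  unfolding partial_deriv_def
proof (rule sum.neutral, rule ballI)
  fix t assume "t \<in> Poly_Mapping.keys P"
  with assms have "v \<notin> Poly_Mapping.keys t" by (auto simp: vars_def)
  then have "Poly_Mapping.lookup t v = 0" by (simp add: in_keys_iff)
  then show "Poly_Mapping.single (t - Poly_Mapping.single v 1)
      (of_nat (Poly_Mapping.lookup t v) * Poly_Mapping.lookup P t) = 0" by simp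
qed

lemma vars_add: "vars (P + Q) \<subseteq> vars P \<union> vars Q"
  unfolding vars_def UN_Un[symmetric] by (rule UN_mono[OF keys_add subset_refl])

lemma vars_mult: "vars (P * Q) \<subseteq> vars P \<union> vars Q"
proof
  fix v assume "v \<in> vars (P * Q)"
  then obtain t where "t \<in> Poly_Mapping.keys (P * Q)" and v: "v \<in> Poly_Mapping.keys t"
    by (auto simp: vars_def)
  then obtain r s where rs: "r \<in> Poly_Mapping.keys P" "s \<in> Poly_Mapping.keys Q" and "t = r + s"
    using keys_mult[of P Q] by fast
  then have "v \<in> Poly_Mapping.keys r \<union> Poly_Mapping.keys s"
    using keys_add[of r s] v by fast
  then show "v \<in> vars P \<union> vars Q" using rs by (auto simp: vars_def)
qed

text \<open>The sum in \<open>dderiv\<close> runs over the variables of its argument. A common index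
  set makes the sums for \<open>P\<close>, \<open>Q\<close>, \<open>P + Q\<close> and
  \<open>P * Q\<close> comparable; additional variables contribute zero partial derivatives.\<close>

lemma dderiv_superset:
  assumes "finite V" "vars P \<subseteq> V"
  shows "dderiv P = coeff_deriv P +
    (\<Sum>v\<in>V. partial_deriv v P * var (indet_of v) (Suc (ord_of v)))"
  unfolding dderiv_def
  by (intro arg_cong2[of _ _ _ _ plus] sum.mono_neutral_left)
    (use assms in \<open>auto simp: partial_deriv_eq_0\<close>)

lemma dderiv_add: "dderiv (P + Q) = dderiv P + dderiv Q"
  by (simp add: dderiv_superset[where V = "vars P \<union> vars Q"] vars_add coeff_deriv_add
      partial_deriv_add distrib_right sum.distrib)

lemma dderiv_mult: "dderiv (P * Q) = dderiv P * Q + P * dderiv Q"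
proof -
  let ?V = "vars P \<union> vars Q"
  define d where "d P = (\<Sum>v\<in>?V. partial_deriv v P * var (indet_of v) (Suc (ord_of v)))"
    for P :: "'a dpoly"
  have d: "d (P * Q) = d P * Q + P * d Q"
    unfolding d_def sum_distrib_left sum_distrib_right sum.distrib[symmetric]
    by (rule sum.cong) (simp_all add: partial_deriv_mult algebra_simps)
  have *: "dderiv R = coeff_deriv R + d R" if "vars R \<subseteq> ?V" for R
    unfolding d_def by (rule dderiv_superset) (use that in auto)
  have "dderiv (P * Q) = coeff_deriv P * Q + P * coeff_deriv Q + (d P * Q + P * d Q)"
    using *[OF vars_mult] d coeff_deriv_mult[of P Q] by simp
  also have "\<dots> = (coeff_deriv P + d P) * Q + P * (coeff_deriv Q + d Q)"
    by (simp only: distrib_left distrib_right ac_simps)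
  also have "\<dots> = dderiv P * Q + P * dderiv Q"
    using *[of P] *[of Q] by simp
  finally show ?thesis .
qed

section \<open>Algebraic dependence\<close>

lemma const_0 [simp]: "const 0 = 0"
  by (simp add: const_def)

lemma lookup_const_mult:
  "Poly_Mapping.lookup (const c * P) t = c * Poly_Mapping.lookup P t"
proof -
  have "Poly_Mapping.lookup (const c * P) t =
      (\<Sum>a. c * (\<Sum>q. Poly_Mapping.lookup P q when t = a + q) when a = 0)"
    by (simp add: const_def lookup_mult lookup_single when_mult eq_commute[of 0])
  then show ?thesis by simp
qed

lemma vars_const [simp]: "vars (const c) = {}"
  by (simp add: vars_def const_def)

lemma vars_0 [simp]: "vars 0 = {}"
  by (simp add: vars_def)

lemma vars_single: "vars (Poly_Mapping.single t c) \<subseteq> Poly_Mapping.keys t"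
  by (simp add: vars_def)

lemma vars_var [simp]: "vars (var X j) = {Deriv X j}"
  by (simp add: vars_def var_def)

lemma polys_in_const [simp]: "const c \<in> polys_in V"
  by (simp add: polys_in_def)

lemma polys_in_0 [simp]: "0 \<in> polys_in V"
  by (simp add: polys_in_def)

lemma polys_in_1 [simp]: "1 \<in> polys_in V"
  using polys_in_const[of 1] by (simp add: const_def)

lemma polys_in_var [simp]: "var X j \<in> polys_in V \<longleftrightarrow> Deriv X j \<in> V"
  by (simp add: polys_in_def)

lemma polys_in_add: "P \<in> polys_in V \<Longrightarrow> Q \<in> polys_in V \<Longrightarrow> P + Q \<in> polys_in V"
  using vars_add[of P Q] by (simp add: polys_in_def) blast

lemma polys_in_mult: "P \<in> polys_in V \<Longrightarrow> Q \<in> polys_in V \<Longrightarrow> P * Q \<in> polys_in V"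
  using vars_mult[of P Q] by (simp add: polys_in_def) blast

lemma polys_in_uminus: "P \<in> polys_in V \<Longrightarrow> - P \<in> polys_in V"
  by (simp add: polys_in_def vars_def in_keys_iff)

lemma polys_in_diff: "P \<in> polys_in V \<Longrightarrow> Q \<in> polys_in V \<Longrightarrow> P - Q \<in> polys_in V"
  using polys_in_add[of P V "- Q"] by (simp add: polys_in_uminus)

lemma polys_in_power: "P \<in> polys_in V \<Longrightarrow> P ^ k \<in> polys_in V"
  by (induction k) (auto intro: polys_in_mult)

lemma polys_in_of_nat: "of_nat k \<in> polys_in V"
  by (induction k) (auto intro: polys_in_add)

lemma polys_in_sum: "(\<And>a. a \<in> A \<Longrightarrow> f a \<in> polys_in V) \<Longrightarrow> sum f A \<in> polys_in V"
  by (induction A rule: infinite_finite_induct) (auto intro: polys_in_add)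

lemma polys_in_prod: "(\<And>a. a \<in> A \<Longrightarrow> f a \<in> polys_in V) \<Longrightarrow> prod f A \<in> polys_in V"
  by (induction A rule: infinite_finite_induct) (auto intro: polys_in_mult)

lemma polys_in_mono: "V \<subseteq> V' \<Longrightarrow> P \<in> polys_in V \<Longrightarrow> P \<in> polys_in V'"
  unfolding polys_in_def by blast

text \<open>Gaussian elimination, one equation at a time: an unknown with a non-zero coefficient in
  the equation is eliminated, and the induction hypothesis solves the remaining system.\<close>

lemma linear_dependence:
  fixes f :: "'a \<Rightarrow> 'b \<Rightarrow> 'c::field"
  assumes "finite B" "finite A" "card B < card A"
  shows "\<exists>c. (\<exists>a\<in>A. c a \<noteq> 0) \<and> (\<forall>b\<in>B. (\<Sum>a\<in>A. c a * f a b) = 0)"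
  using assms
proof (induction B arbitrary: A f rule: finite_induct)
  case empty
  then have "A \<noteq> {}" by auto
  then show ?case by (intro exI[of _ "\<lambda>_. 1"]) auto
next
  case (insert b B)
  show ?case
  proof (cases "\<forall>a\<in>A. f a b = 0")
    case True
    from insert have "card B < card A" by simp
    then obtain c where "\<exists>a\<in>A. c a \<noteq> 0" "\<forall>b\<in>B. (\<Sum>a\<in>A. c a * f a b) = 0"
      using insert.IH[of A f] insert.prems by blast
    with True show ?thesis by (intro exI[of _ c]) auto
  next
    case False
    then obtain a0 where a0: "a0 \<in> A" "f a0 b \<noteq> 0" by auto
    define A' where "A' = A - {a0}"
    have A: "finite A'" "A = insert a0 A'" "a0 \<notin> A'"
      using a0 insert.prems by (auto simp: A'_def)
    then have "card B < card A'" using insert by simp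
    then obtain c where c: "\<exists>a\<in>A'. c a \<noteq> 0"
      and c0: "\<And>b'. b' \<in> B \<Longrightarrow> (\<Sum>a\<in>A'. c a * (f a b' - f a b / f a0 b * f a0 b')) = 0"
      using insert.IH[of A' "\<lambda>a b'. f a b' - f a b / f a0 b * f a0 b'"] A(1) by blast
    \<comment> \<open>The pivot unknown \<open>a0\<close> takes the value that solves equation
      \<open>b\<close>. Substituting it turns every equation into the reduced one, which for
      \<open>b\<close> itself has only zero coefficients.\<close>
    define c' where "c' a = (if a = a0 then - (\<Sum>a\<in>A'. c a * f a b) / f a0 b else c a)" for a
    have sum: "(\<Sum>a\<in>A. c' a * f a b') =
        (\<Sum>a\<in>A'. c a * (f a b' - f a b / f a0 b * f a0 b'))" for b'
    proof -
      have "(\<Sum>a\<in>A'. c' a * f a b') = (\<Sum>a\<in>A'. c a * f a b')"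
        using A(3) by (intro sum.cong) (auto simp: c'_def)
      then have "(\<Sum>a\<in>A. c' a * f a b') = (\<Sum>a\<in>A'. c a * f a b')
          - (\<Sum>a\<in>A'. c a * f a b) * (f a0 b' / f a0 b)"
        using A by (simp add: c'_def)
      also have "\<dots> = (\<Sum>a\<in>A'. c a * f a b' - c a * f a b * (f a0 b' / f a0 b))"
        by (simp only: sum_subtractf sum_distrib_right)
      also have "\<dots> = (\<Sum>a\<in>A'. c a * (f a b' - f a b / f a0 b * f a0 b'))"
        by (rule sum.cong) (simp_all add: right_diff_distrib)
      finally show ?thesis .
    qed
    have "\<forall>b'\<in>insert b B. (\<Sum>a\<in>A. c' a * f a b') = 0"
      unfolding sum using c0 a0(2) by simp
    moreover have "\<exists>a\<in>A. c' a \<noteq> 0" using c A by (auto simp: c'_def)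
    ultimately show ?thesis by blast
  qed
qed

text \<open>Bounding each exponent separately, rather than the total degree, makes this a box that
  is counted exactly.\<close>

definition monomials :: "'a set \<Rightarrow> nat \<Rightarrow> ('a \<Rightarrow>\<^sub>0 nat) set" where
  "monomials V d = {t. Poly_Mapping.keys t \<subseteq> V \<and> (\<forall>v. Poly_Mapping.lookup t v \<le> d)}"

lemma card_monomials:
  assumes "finite V"
  shows "finite (monomials V d)" and "card (monomials V d) = (d + 1) ^ card V"
proof -
  let ?r = "\<lambda>t. restrict (Poly_Mapping.lookup t) V"
  have bij: "bij_betw ?r (monomials V d) (PiE V (\<lambda>_. {..d}))"
    unfolding bij_betw_def
  proof (intro conjI equalityI subsetI inj_onI)
    fix s t :: "'a \<Rightarrow>\<^sub>0 nat"
    assume st: "s \<in> monomials V d" "t \<in> monomials V d" "?r s = ?r t"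
    show "s = t"
    proof (rule poly_mapping_eqI)
      fix v
      show "Poly_Mapping.lookup s v = Poly_Mapping.lookup t v"
      proof (cases "v \<in> V")
        case True
        then show ?thesis using fun_cong[OF st(3), of v] by simp
      next
        case False
        then have "v \<notin> Poly_Mapping.keys s" "v \<notin> Poly_Mapping.keys t"
          using st by (auto simp: monomials_def)
        then show ?thesis by (simp add: in_keys_iff)
      qed
    qed
  next
    fix f assume "f \<in> ?r ` monomials V d"
    then show "f \<in> PiE V (\<lambda>_. {..d})" by (auto simp: monomials_def)
  next
    fix f assume f: "f \<in> PiE V (\<lambda>_. {..d})"
    let ?g = "\<lambda>v. if v \<in> V then f v else 0"
    have lookup: "Poly_Mapping.lookup (Abs_poly_mapping ?g) = ?g"
      by (rule lookup_Abs_poly_mapping) (rule finite_subset[OF _ assms], auto)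
    have "Abs_poly_mapping ?g \<in> monomials V d"
      unfolding monomials_def mem_Collect_eq lookup
      using f by (auto simp: in_keys_iff lookup PiE_iff split: if_splits)
    moreover have "?r (Abs_poly_mapping ?g) = f"
      using f unfolding lookup PiE_def extensional_def restrict_def by auto
    ultimately show "f \<in> ?r ` monomials V d"
      by (intro image_eqI[of f ?r "Abs_poly_mapping ?g"]) simp_all
  qed
  have "finite (PiE V (\<lambda>_. {..d}))" by (rule finite_PiE) (use assms in auto)
  then show "finite (monomials V d)" using bij_betw_finite[OF bij] by simp
  show "card (monomials V d) = (d + 1) ^ card V"
    using bij_betw_same_card[OF bij] assms by (simp add: card_PiE)
qed

text \<open>The bound concerns the exponents of single variables, as in \<open>monomials\<close>,
  not the total degree.\<close>

definition degree_le :: "nat \<Rightarrow> 'k::field_char_0 dpoly \<Rightarrow> bool" where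
  "degree_le d P \<longleftrightarrow> (\<forall>t\<in>Poly_Mapping.keys P. \<forall>v. Poly_Mapping.lookup t v \<le> d)"

lemma degree_le_ex: "\<exists>d. degree_le d P"
proof
  let ?m = "\<lambda>t. \<Sum>v\<in>Poly_Mapping.keys t. Poly_Mapping.lookup t v"
  show "degree_le (\<Sum>t\<in>Poly_Mapping.keys P. ?m t) P"
    unfolding degree_le_def
  proof (intro ballI allI)
    fix t v assume t: "t \<in> Poly_Mapping.keys P"
    have "Poly_Mapping.lookup t v \<le> ?m t"
      by (cases "v \<in> Poly_Mapping.keys t") (auto simp: in_keys_iff intro!: member_le_sum)
    also have "\<dots> \<le> (\<Sum>t\<in>Poly_Mapping.keys P. ?m t)"
      by (rule member_le_sum[OF t]) simp_all
    finally show "Poly_Mapping.lookup t v \<le> (\<Sum>t\<in>Poly_Mapping.keys P. ?m t)" .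
  qed
qed

lemma degree_le_mono: "degree_le d P \<Longrightarrow> d \<le> e \<Longrightarrow> degree_le e P"
  unfolding degree_le_def using order_trans by blast

lemma degree_le_1: "degree_le d 1"
  by (simp add: degree_le_def)

lemma degree_le_mult:
  assumes "degree_le d P" "degree_le e Q"
  shows "degree_le (d + e) (P * Q)"
  unfolding degree_le_def
proof (intro ballI allI)
  fix t v assume "t \<in> Poly_Mapping.keys (P * Q)"
  then obtain r s where "r \<in> Poly_Mapping.keys P" "s \<in> Poly_Mapping.keys Q" and t: "t = r + s"
    using keys_mult[of P Q] by fast
  then have "Poly_Mapping.lookup r v \<le> d" "Poly_Mapping.lookup s v \<le> e"
    using assms unfolding degree_le_def by blast+
  then show "Poly_Mapping.lookup t v \<le> d + e" by (simp add: t lookup_add add_mono)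
qed

lemma degree_le_power: "degree_le d P \<Longrightarrow> degree_le (k * d) (P ^ k)"
  by (induction k) (simp_all add: degree_le_1 degree_le_mult)

lemma degree_le_prod:
  "(\<And>a. a \<in> A \<Longrightarrow> degree_le d (f a)) \<Longrightarrow> degree_le (card A * d) (prod f A)"
  by (induction A rule: infinite_finite_induct) (simp_all add: degree_le_1 degree_le_mult)

text \<open>Because \<open>d * M + 1 \<le> (d + 1) * (M + 1)\<close>, the left side is at most
  \<open>(d + 1) ^ k\<close> times the constant \<open>(M + 1) ^ k\<close>. Taking \<open>d\<close>
  equal to this constant keeps it below \<open>(d + 1) ^ (k + 1)\<close>.\<close>

lemma count_bound:
  fixes M k l :: nat
  assumes "k < l" and d: "d = (M + 1) ^ k"
  shows "(d * M + 1) ^ k < (d + 1) ^ l"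
proof -
  have "(d * M + 1) ^ k \<le> ((d + 1) * (M + 1)) ^ k"
    by (rule power_mono) simp_all
  also have "\<dots> = (d + 1) ^ k * d" by (simp only: power_mult_distrib d)
  also have "\<dots> < (d + 1) ^ Suc k" by simp
  also have "\<dots> \<le> (d + 1) ^ l" using assms by (intro power_increasing) auto
  finally show ?thesis .
qed

text \<open>Clearing denominators, this says that the fractions \<open>C v / H v\<close> are algebraically dependent:
  for large \<open>d\<close> there are more monomials of degree at most \<open>d\<close> in the variables of \<open>X\<close> than
  coefficients in the products below.\<close>

lemma algebraic_dependence:
  fixes H C :: "dvar \<Rightarrow> 'k::field_char_0 dpoly"
  assumes "finite V" "finite X" "card V < card X"
    and H: "\<And>v. v \<in> X \<Longrightarrow> H v \<in> polys_in V" and C: "\<And>v. v \<in> X \<Longrightarrow> C v \<in> polys_in V"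
  obtains d and P :: "'k dpoly" where "P \<in> polys_in X" "P \<noteq> 0" "degree_le d P"
    and "(\<Sum>t\<in>Poly_Mapping.keys P. const (Poly_Mapping.lookup P t) *
           (\<Prod>v\<in>X. H v ^ (d - Poly_Mapping.lookup t v) * C v ^ Poly_Mapping.lookup t v)) = 0"
proof -
  define e where "e v = (SOME e. degree_le e (H v)) + (SOME e. degree_le e (C v))" for v
  define E where "E = (\<Sum>v\<in>X. e v)"
  have E: "degree_le E (H v)" "degree_le E (C v)" if "v \<in> X" for v
  proof -
    have "e v \<le> E" unfolding E_def by (rule member_le_sum) (use that assms in auto)
    then show "degree_le E (H v)" "degree_le E (C v)"
      using someI_ex[OF degree_le_ex[of "H v"]] someI_ex[OF degree_le_ex[of "C v"]]
      by (auto simp: e_def intro: degree_le_mono)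
  qed
  \<comment> \<open>The two powers in each factor of \<open>G t\<close> have exponents adding up to
    \<open>d\<close>, and there are \<open>card X\<close> factors, so all exponents in
    \<open>G t\<close> are at most \<open>card X * (d * E) = d * M\<close>.\<close>
  define M d where "M = card X * E" and "d = (M + 1) ^ card V"
  let ?A = "monomials X d" and ?B = "monomials V (d * M)"
  \<comment> \<open>Formally, this is the monomial \<open>t\<close> evaluated at the fractions
    \<open>C v / H v\<close> and multiplied by the common denominator, the product of all
    \<open>H v ^ d\<close>.\<close>
  define G where
    "G t = (\<Prod>v\<in>X. H v ^ (d - Poly_Mapping.lookup t v) * C v ^ Poly_Mapping.lookup t v)" for t
  have G: "Poly_Mapping.keys (G t) \<subseteq> ?B" if t: "t \<in> ?A" for t
  proof -
    have "G t \<in> polys_in V"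
      unfolding G_def by (intro polys_in_prod polys_in_mult polys_in_power H C)
    then have 1: "Poly_Mapping.keys s \<subseteq> V" if "s \<in> Poly_Mapping.keys (G t)" for s
      using that by (auto simp: polys_in_def vars_def)
    have "degree_le (card X * (d * E)) (G t)"
      unfolding G_def
    proof (rule degree_le_prod)
      fix v assume "v \<in> X"
      then have "degree_le ((d - Poly_Mapping.lookup t v) * E + Poly_Mapping.lookup t v * E)
          (H v ^ (d - Poly_Mapping.lookup t v) * C v ^ Poly_Mapping.lookup t v)"
        by (intro degree_le_mult degree_le_power E)
      moreover have "Poly_Mapping.lookup t v \<le> d" using t by (simp add: monomials_def)
      ultimately show "degree_le (d * E)
          (H v ^ (d - Poly_Mapping.lookup t v) * C v ^ Poly_Mapping.lookup t v)"
        by (simp flip: add_mult_distrib)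
    qed
    then have "degree_le (d * M) (G t)" by (simp add: M_def mult.left_commute)
    with 1 show ?thesis unfolding monomials_def degree_le_def by blast
  qed
  have "card ?B < card ?A"
    using count_bound[OF assms(3) d_def] assms(1,2) by (simp add: card_monomials(2))
  \<comment> \<open>The unknowns are the coefficients of the relation; there is one equation for
    each coefficient that has to vanish in the combination of the \<open>G t\<close>.\<close>
  then obtain c where c: "\<exists>t\<in>?A. c t \<noteq> 0"
    and c0: "\<And>s. s \<in> ?B \<Longrightarrow> (\<Sum>t\<in>?A. c t * Poly_Mapping.lookup (G t) s) = 0"
    using linear_dependence[OF card_monomials(1) card_monomials(1), of V X "d * M" d
        "\<lambda>t. Poly_Mapping.lookup (G t)"] assms(1,2) by blast
  define P where "P = (\<Sum>t\<in>?A. Poly_Mapping.single t (c t))"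
  have finA: "finite ?A" by (rule card_monomials(1)[OF assms(2)])
  have P: "Poly_Mapping.lookup P t = (if t \<in> ?A then c t else 0)" for t
    unfolding P_def lookup_sum lookup_single when_def using finA by (simp add: sum.delta)
  have keysP: "Poly_Mapping.keys P \<subseteq> ?A" by (auto simp: in_keys_iff P split: if_splits)
  show thesis
  proof (rule that)
    show "P \<in> polys_in X" using keysP by (auto simp: polys_in_def vars_def monomials_def)
    show "degree_le d P" using keysP by (auto simp: degree_le_def monomials_def)
    from c obtain t where "t \<in> ?A" "c t \<noteq> 0" by blast
    then have "Poly_Mapping.lookup P t \<noteq> 0" by (simp add: P)
    then show "P \<noteq> 0" by (metis lookup_zero)
    have "(\<Sum>t\<in>Poly_Mapping.keys P. const (Poly_Mapping.lookup P t) * G t)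
        = (\<Sum>t\<in>?A. const (Poly_Mapping.lookup P t) * G t)"
      by (rule sum.mono_neutral_left[OF finA keysP]) (simp add: in_keys_iff)
    also have "\<dots> = 0"
    proof (rule poly_mapping_eqI)
      fix s
      have "Poly_Mapping.lookup (\<Sum>t\<in>?A. const (Poly_Mapping.lookup P t) * G t) s
          = (\<Sum>t\<in>?A. c t * Poly_Mapping.lookup (G t) s)"
        unfolding lookup_sum lookup_const_mult by (rule sum.cong) (simp_all add: P)
      also have "\<dots> = 0"
      proof (cases "s \<in> ?B")
        case False
        then have "Poly_Mapping.lookup (G t) s = 0" if "t \<in> ?A" for t
          using G[OF that] by (meson in_keys_iff subsetD)
        then show ?thesis by simp
      qed (rule c0)
      finally show "Poly_Mapping.lookup (\<Sum>t\<in>?A. const (Poly_Mapping.lookup P t) * G t) s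
          = Poly_Mapping.lookup 0 s" by simp
    qed
    finally show "(\<Sum>t\<in>Poly_Mapping.keys P. const (Poly_Mapping.lookup P t) *
        (\<Prod>v\<in>X. H v ^ (d - Poly_Mapping.lookup t v) * C v ^ Poly_Mapping.lookup t v)) = 0"
      unfolding G_def .
  qed
qed

section \<open>The ideal of a dynamical model\<close>

text \<open>The additional factor \<open>x\<close> avoids the exponent \<open>k - 1\<close>, so
  \<open>k = 0\<close> is covered as well.\<close>

lemma Leibniz_power':
  fixes D :: "'a::comm_ring_1 \<Rightarrow> 'a"
  assumes "\<And>x y. D (x * y) = D x * y + x * D y"
  shows "x * D (x ^ k) = of_nat k * x ^ k * D x"
proof (cases k)
  case 0
  have "D 1 = 0" using assms[of 1 1] by simp
  with 0 show ?thesis by simp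
next
  case (Suc l)
  have "D (x ^ Suc l) = of_nat (Suc l) * x ^ l * D x" by (rule Leibniz_power) (rule assms)
  then show ?thesis unfolding Suc by (simp add: algebra_simps)
qed

text \<open>The rings of the individual models are subsets of one type, so ideals are taken relative
  to a subset \<open>R\<close>. Congruence modulo \<open>I\<close> is expressed by differences lying
  in \<open>I\<close>.\<close>

locale relative_ideal =
  fixes R I :: "'a::comm_ring_1 set"
  assumes R_1: "1 \<in> R"
    and R_diff: "x \<in> R \<Longrightarrow> y \<in> R \<Longrightarrow> x - y \<in> R"
    and R_mult: "x \<in> R \<Longrightarrow> y \<in> R \<Longrightarrow> x * y \<in> R"
    and I_0: "0 \<in> I"
    and I_add: "x \<in> I \<Longrightarrow> y \<in> I \<Longrightarrow> x + y \<in> I"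
    and I_mult: "r \<in> R \<Longrightarrow> x \<in> I \<Longrightarrow> r * x \<in> I"
begin

lemma R_0: "0 \<in> R"
  using R_diff[OF R_1 R_1] by simp

lemma R_uminus: "x \<in> R \<Longrightarrow> - x \<in> R"
  using R_diff[OF R_0] by simp

lemma R_add: "x \<in> R \<Longrightarrow> y \<in> R \<Longrightarrow> x + y \<in> R"
  using R_diff[of x "- y"] R_uminus by simp

lemma R_power: "x \<in> R \<Longrightarrow> x ^ k \<in> R"
  by (induction k) (simp_all add: R_1 R_mult)

lemma R_of_nat: "of_nat k \<in> R"
  by (induction k) (simp_all add: R_0 R_1 R_add)

lemma R_prod: "(\<And>a. a \<in> A \<Longrightarrow> f a \<in> R) \<Longrightarrow> prod f A \<in> R"
  by (induction A rule: infinite_finite_induct) (simp_all add: R_1 R_mult)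

lemma I_uminus: "x \<in> I \<Longrightarrow> - x \<in> I"
  using I_mult[OF R_uminus[OF R_1]] by simp

lemma I_diff: "x \<in> I \<Longrightarrow> y \<in> I \<Longrightarrow> x - y \<in> I"
  using I_add[of x "- y"] I_uminus by simp

lemma I_sum: "(\<And>a. a \<in> A \<Longrightarrow> f a \<in> I) \<Longrightarrow> sum f A \<in> I"
  by (induction A rule: infinite_finite_induct) (simp_all add: I_0 I_add)

lemma I_mult_diff:
  assumes "x \<in> R" "y' \<in> R" "x - x' \<in> I" "y - y' \<in> I"
  shows "x * y - x' * y' \<in> I"
proof -
  have "x * y - x' * y' = x * (y - y') + y' * (x - x')" by (simp add: algebra_simps)
  then show ?thesis using assms by (simp add: I_add I_mult)
qed

lemma I_power_diff:
  assumes "x \<in> R" "x' \<in> R" "x - x' \<in> I"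
  shows "x ^ k - x' ^ k \<in> I"
  by (induction k) (use assms in \<open>simp_all add: I_0 I_mult_diff R_power\<close>)

lemma I_prod_diff:
  assumes "\<And>a. a \<in> A \<Longrightarrow> f a \<in> R" "\<And>a. a \<in> A \<Longrightarrow> g a \<in> R" "\<And>a. a \<in> A \<Longrightarrow> f a - g a \<in> I"
  shows "prod f A - prod g A \<in> I"
  using assms
  by (induction A rule: infinite_finite_induct) (simp_all add: I_0 I_mult_diff R_prod)

text \<open>Differentiating the congruence of \<open>q ^ k * p\<close> and \<open>b\<close> gives
  the term \<open>k * q ^ (k - 1) * D q * p\<close>. Of the two additional factors \<open>q\<close>,
  one turns \<open>D q\<close> into \<open>q'\<close>, the other restores \<open>q ^ k * p\<close>,
  which is \<open>b\<close> modulo \<open>I\<close>.\<close>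

lemma I_reduced_deriv:
  fixes D :: "'a \<Rightarrow> 'a"
  assumes D_add: "\<And>x y. D (x + y) = D x + D y"
    and D_mult: "\<And>x y. D (x * y) = D x * y + x * D y"
    and I_D: "\<And>x. x \<in> I \<Longrightarrow> D x \<in> I"
    and R: "q \<in> R" "D q \<in> R" "b \<in> R"
    and I: "q ^ k * p - b \<in> I" "q * D q - q' \<in> I" "q * D b - b' \<in> I"
  shows "q ^ (k + 2) * D p - (q * b' - of_nat k * b * q') \<in> I"
proof -
  have "D (q ^ k * p - b) = D (q ^ k) * p + q ^ k * D p - D b"
    by (simp only: additive_diff[where D = D, OF D_add] D_mult)
  then have "q * D (q ^ k * p - b) = q * (D (q ^ k) * p + q ^ k * D p - D b)"
    by (rule arg_cong)
  also have "\<dots> = q * D (q ^ k) * p + q ^ Suc k * D p - q * D b"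
    by (simp add: algebra_simps)
  also have "\<dots> = of_nat k * q ^ k * D q * p + q ^ Suc k * D p - q * D b"
    by (simp only: Leibniz_power'[of D, OF D_mult])
  finally have eq: "q * D (q ^ k * p - b) =
      of_nat k * q ^ k * D q * p + q ^ Suc k * D p - q * D b" .
  have "q ^ (k + 2) * D p - (q * b' - of_nat k * b * q') =
      q * (q * D (q ^ k * p - b)) - of_nat k * (q * D q) * (q ^ k * p - b)
      - of_nat k * b * (q * D q - q') + q * (q * D b - b')"
    unfolding eq by (simp add: algebra_simps power2_eq_square)
  also have "\<dots> \<in> I"
    by (intro I_add I_diff I_mult I_D I R_mult R_of_nat R)
  finally show ?thesis .
qed

end

section \<open>Ideals generated relative to a subring\<close>

lemma ideal_generated_add:
  fixes R S :: "'a::comm_ring_1 set"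
  assumes "0 \<in> R" and R_add: "\<And>x y. x \<in> R \<Longrightarrow> y \<in> R \<Longrightarrow> x + y \<in> R"
    and "x \<in> ideal_generated R S" "y \<in> ideal_generated R S"
  shows "x + y \<in> ideal_generated R S"
proof -
  obtain T c where T: "finite T" "T \<subseteq> S" "\<forall>g\<in>T. c g \<in> R" and x: "x = (\<Sum>g\<in>T. c g * g)"
    using assms(3) by (auto simp: ideal_generated_def)
  obtain T' c' where T': "finite T'" "T' \<subseteq> S" "\<forall>g\<in>T'. c' g \<in> R" and y: "y = (\<Sum>g\<in>T'. c' g * g)"
    using assms(4) by (auto simp: ideal_generated_def)
  \<comment> \<open>Both coefficient families are extended by 0 to the union of the two generator
    sets.\<close>
  define e where "e g = (if g \<in> T then c g else 0)" for g
  define e' where "e' g = (if g \<in> T' then c' g else 0)" for g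
  have "x = (\<Sum>g\<in>T \<union> T'. e g * g)" unfolding x
    by (rule sum.mono_neutral_cong_left) (use T T' in \<open>auto simp: e_def\<close>)
  moreover have "y = (\<Sum>g\<in>T \<union> T'. e' g * g)" unfolding y
    by (rule sum.mono_neutral_cong_left) (use T T' in \<open>auto simp: e'_def\<close>)
  ultimately have "x + y = (\<Sum>g\<in>T \<union> T'. (e g + e' g) * g)"
    by (simp add: sum.distrib distrib_right)
  moreover have "\<forall>g\<in>T \<union> T'. e g + e' g \<in> R"
    using T T' assms(1) by (auto simp: e_def e'_def intro!: R_add)
  moreover have "finite (T \<union> T')" "T \<union> T' \<subseteq> S" using T T' by auto
  ultimately show ?thesis
    unfolding ideal_generated_def mem_Collect_eq
    by (intro exI[of _ "T \<union> T'"] exI[of _ "\<lambda>g. e g + e' g"]) blast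
qed

lemma ideal_generated_base:
  "c \<in> R \<Longrightarrow> g \<in> S \<Longrightarrow> c * g \<in> ideal_generated R S"
  unfolding ideal_generated_def mem_Collect_eq
  by (intro exI[of _ "{g}"] exI[of _ "\<lambda>_. c"]) auto

lemma ideal_generated_induct [consumes 1, case_names zero add base]:
  assumes "x \<in> ideal_generated R S"
    and "P 0" and "\<And>x y. P x \<Longrightarrow> P y \<Longrightarrow> P (x + y)"
    and "\<And>c g. c \<in> R \<Longrightarrow> g \<in> S \<Longrightarrow> P (c * g)"
  shows "P x"
proof -
  obtain T c where "finite T" "T \<subseteq> S" "\<forall>g\<in>T. c g \<in> R" and x: "x = (\<Sum>g\<in>T. c g * g)"
    using assms(1) by (auto simp: ideal_generated_def)
  from this(1-3) have "P (\<Sum>g\<in>T. c g * g)"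
    by (induction T rule: finite_induct) (auto intro: assms)
  then show ?thesis unfolding x .
qed

lemma relative_ideal_generated:
  fixes R S :: "'a::comm_ring_1 set"
  assumes "1 \<in> R" and diff: "\<And>x y. x \<in> R \<Longrightarrow> y \<in> R \<Longrightarrow> x - y \<in> R"
    and mult: "\<And>x y. x \<in> R \<Longrightarrow> y \<in> R \<Longrightarrow> x * y \<in> R"
  shows "relative_ideal R (ideal_generated R S)"
proof -
  have R0: "0 \<in> R" using diff[OF assms(1) assms(1)] by simp
  have add: "x + y \<in> R" if "x \<in> R" "y \<in> R" for x y
    using diff[OF that(1) diff[OF R0 that(2)]] by simp
  have zero: "0 \<in> ideal_generated R S"
    unfolding ideal_generated_def mem_Collect_eq
    by (rule exI[of _ "{}"], rule exI[of _ "\<lambda>_. 0"]) simp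
  show ?thesis
  proof
    fix r x assume r: "r \<in> R" and "x \<in> ideal_generated R S"
    from this(2) show "r * x \<in> ideal_generated R S"
    proof (induction rule: ideal_generated_induct)
      case (base c g)
      then show ?case
        using ideal_generated_base[OF mult[OF r base(1)] base(2)] by (simp add: mult.assoc)
    qed (simp_all add: zero distrib_left ideal_generated_add[OF R0 add])
  qed (use assms(1) diff mult zero ideal_generated_add[OF R0 add] in blast)+
qed

text \<open>In \<open>D (c * g) = D c * g + c * D g\<close> both terms are multiples of generators,
  as \<open>S\<close> is closed under \<open>D\<close>.\<close>

lemma ideal_generated_derivation:
  fixes R S :: "'a::comm_ring_1 set" and D :: "'a \<Rightarrow> 'a"
  assumes "relative_ideal R (ideal_generated R S)"
    and add: "\<And>x y. D (x + y) = D x + D y"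
    and mult: "\<And>x y. D (x * y) = D x * y + x * D y"
    and R: "\<And>x. x \<in> R \<Longrightarrow> D x \<in> R" and S: "\<And>g. g \<in> S \<Longrightarrow> D g \<in> S"
    and "x \<in> ideal_generated R S"
  shows "D x \<in> ideal_generated R S"
proof -
  interpret relative_ideal R "ideal_generated R S" by fact
  from assms(6) show ?thesis
  proof (induction rule: ideal_generated_induct)
    case zero
    have "D 0 = 0" using add[of 0 0] by simp
    then show ?case by (simp add: I_0)
  next
    case (add x y)
    then show ?case by (simp add: assms(2) I_add)
  next
    case (base c g)
    then show ?case unfolding mult by (intro I_add ideal_generated_base R S)
  qed
qed

section \<open>Variables of derivatives, and monomials as products\<close>

lemma coeff_deriv_in: "P \<in> polys_in V \<Longrightarrow> coeff_deriv P \<in> polys_in V"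
proof -
  have "Poly_Mapping.keys (coeff_deriv P) \<subseteq> Poly_Mapping.keys P"
    by (rule subsetI) (simp add: in_keys_iff lookup_coeff_deriv, metis ratfun_deriv_0)
  then have "vars (coeff_deriv P) \<subseteq> vars P" unfolding vars_def by (rule UN_mono) simp
  then show "P \<in> polys_in V \<Longrightarrow> coeff_deriv P \<in> polys_in V" by (simp add: polys_in_def)
qed

lemma partial_deriv_in:
  assumes "P \<in> polys_in V"
  shows "partial_deriv v P \<in> polys_in V"
  unfolding partial_deriv_def
proof (rule polys_in_sum)
  fix t assume "t \<in> Poly_Mapping.keys P"
  then have "Poly_Mapping.keys t \<subseteq> V" using assms by (auto simp: polys_in_def vars_def)
  moreover have "Poly_Mapping.keys (t - Poly_Mapping.single v 1) \<subseteq> Poly_Mapping.keys t"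
    by (auto simp: in_keys_iff lookup_minus)
  ultimately show "Poly_Mapping.single (t - Poly_Mapping.single v 1)
      (of_nat (Poly_Mapping.lookup t v) * Poly_Mapping.lookup P t) \<in> polys_in V"
    unfolding polys_in_def using vars_single by blast
qed

lemma dderiv_in:
  assumes "P \<in> polys_in (dvars_of A)"
  shows "dderiv P \<in> polys_in (dvars_of A)"
  unfolding dderiv_def
proof (intro polys_in_add coeff_deriv_in polys_in_sum polys_in_mult partial_deriv_in assms)
  fix v assume "v \<in> vars P"
  then have "v \<in> dvars_of A" using assms unfolding polys_in_def by blast
  then show "var (indet_of v) (Suc (ord_of v)) \<in> polys_in (dvars_of A)"
    by (auto simp: dvars_of_def)
qed

lemma dderiv_var: "dderiv (var X j) = var X (Suc j)"
proof -
  have "ratfun_deriv 1 = (0 :: 'a ratfun)"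
    using ratfun_deriv_Fract[of 1 1] by (simp add: fract_collapse)
  then have "coeff_deriv (var X j :: 'a dpoly) = 0"
    by (simp add: var_def coeff_deriv_single)
  moreover have "partial_deriv (Deriv X j) (var X j :: 'a dpoly) = 1"
    unfolding var_def partial_deriv_single by simp
  ultimately show ?thesis by (simp add: dderiv_def)
qed

text \<open>Allowing any finite \<open>A\<close> that contains the variables of \<open>t\<close>
  lets one index set serve all terms of a polynomial.\<close>

lemma single_conv_prod:
  assumes "finite A" "Poly_Mapping.keys t \<subseteq> A"
  shows "Poly_Mapping.single t c = const c *
    (\<Prod>v\<in>A. var (indet_of v) (ord_of v) ^ Poly_Mapping.lookup t v)"
proof -
  have power: "(Poly_Mapping.single s 1 :: 'a dpoly) ^ k = Poly_Mapping.single (\<Sum>i<k. s) 1"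
    for s :: "dvar \<Rightarrow>\<^sub>0 nat" and k
    by (induction k) (simp_all add: mult_single add.commute)
  have scale: "(\<Sum>i<k. Poly_Mapping.single v 1) = Poly_Mapping.single v k" for v :: dvar and k :: nat
    by (induction k) (simp_all flip: single_add)
  have prod: "(\<Prod>v\<in>B. Poly_Mapping.single (f v) 1 :: 'a dpoly) = Poly_Mapping.single (sum f B) 1"
    for f :: "dvar \<Rightarrow> dvar \<Rightarrow>\<^sub>0 nat" and B
    by (induction B rule: infinite_finite_induct) (simp_all add: mult_single)
  have t: "(\<Sum>v\<in>A. Poly_Mapping.single v (Poly_Mapping.lookup t v)) = t"
  proof (rule poly_mapping_eqI)
    fix u
    have "(\<Sum>v\<in>A. Poly_Mapping.lookup (Poly_Mapping.single v (Poly_Mapping.lookup t v)) u)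
        = (\<Sum>v\<in>A. if v = u then Poly_Mapping.lookup t v else 0)"
      by (rule sum.cong) (simp_all add: lookup_single when_def)
    also have "\<dots> = Poly_Mapping.lookup t u"
      using assms by (auto simp: sum.delta in_keys_iff)
    finally show "Poly_Mapping.lookup (\<Sum>v\<in>A. Poly_Mapping.single v (Poly_Mapping.lookup t v)) u
        = Poly_Mapping.lookup t u" unfolding lookup_sum .
  qed
  have "var (indet_of v) (ord_of v) ^ Poly_Mapping.lookup t v =
      (Poly_Mapping.single (Poly_Mapping.single v (Poly_Mapping.lookup t v)) 1 :: 'a dpoly)" for v
    unfolding var_def power scale by simp
  then have "(\<Prod>v\<in>A. var (indet_of v) (ord_of v) ^ Poly_Mapping.lookup t v) =
      (Poly_Mapping.single t 1 :: 'a dpoly)"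
    by (simp only: prod t)
  then show ?thesis by (simp add: const_def mult_single)
qed

lemma card_state_vars: "finite (state_vars N)" "card (state_vars N) = N"
proof -
  have *: "state_vars N = (\<lambda>i. Deriv (U i) 0) ` {1..N}" by (auto simp: state_vars_def)
  show "finite (state_vars N)" unfolding * by simp
  show "card (state_vars N) = N" unfolding * by (subst card_image) (auto simp: inj_on_def)
qed

text \<open>Some variable has to occur, since \<open>dorder\<close> is otherwise the unspecified
  maximum of the empty set.\<close>

lemma dorder_le:
  assumes "vars P \<noteq> {}" "vars P \<subseteq> {Deriv X j | j. j \<le> N}"
  shows "dorder X P \<le> N"
proof -
  have "{j. Deriv X j \<in> vars P} \<subseteq> {..N}" using assms(2) by auto
  moreover from assms obtain j where "Deriv X j \<in> vars P" by blast
  ultimately show ?thesis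
    unfolding dorder_def by (subst Max_le_iff) (auto intro: finite_subset)
qed

lemma diff_ideal_generated_ideal:
  "relative_ideal (polys_in V) (diff_ideal_generated (polys_in V) S)"
  unfolding diff_ideal_generated_def
  by (rule relative_ideal_generated) (simp_all only: polys_in_1 polys_in_diff polys_in_mult)

lemma diff_ideal_generated_gen:
  assumes "g \<in> S"
  shows "g \<in> diff_ideal_generated (polys_in V) S"
proof -
  have "g \<in> {(dderiv ^^ k) g | k g. g \<in> S}"
    unfolding mem_Collect_eq by (intro exI[of _ 0] exI[of _ g]) (simp add: assms)
  from ideal_generated_base[OF polys_in_1 this] show ?thesis
    unfolding diff_ideal_generated_def by simp
qed

lemma diff_ideal_generated_dderiv:
  assumes "x \<in> diff_ideal_generated (polys_in (dvars_of A)) S"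
  shows "dderiv x \<in> diff_ideal_generated (polys_in (dvars_of A)) S"
  using assms diff_ideal_generated_ideal[of "dvars_of A" S] unfolding diff_ideal_generated_def
proof (intro ideal_generated_derivation[of _ _ dderiv])
  fix g assume "g \<in> {(dderiv ^^ k) g | k g. g \<in> S}"
  then obtain k h where "g = (dderiv ^^ k) h" "h \<in> S" by blast
  then show "dderiv g \<in> {(dderiv ^^ k) g | k g. g \<in> S}"
    unfolding mem_Collect_eq by (intro exI[of _ "Suc k"] exI[of _ h]) simp
qed (assumption | rule dderiv_add dderiv_mult dderiv_in)+

lemma model_elimination:
  fixes Q b :: "'k::field_char_0 dpoly" and a :: "nat \<Rightarrow> 'k dpoly"
  assumes Q: "Q \<in> polys_in (state_vars N)" and b: "b \<in> polys_in (state_vars N)"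
    and a: "\<And>i. i \<in> {1..N} \<Longrightarrow> a i \<in> polys_in (state_vars N)"
  defines "R \<equiv> model_ring N"
  defines "I \<equiv> diff_ideal_generated R
    (insert (Q * var W 0 - b) ((\<lambda>i. Q * var (U i) 1 - a i) ` {1..N}))"
  obtains P where "P \<in> saturation R I Q" "P \<in> polys_in (dvars_of {W})" "P \<noteq> 0"
    and "dorder W P \<le> N"
proof -
  define S where "S = insert (Q * var W 0 - b) ((\<lambda>i. Q * var (U i) 1 - a i) ` {1..N})"
  have I: "I = diff_ideal_generated (polys_in (dvars_of (insert W (U ` {1..N})))) S"
    by (simp add: I_def R_def S_def model_ring_def)
  interpret relative_ideal R I
    unfolding I R_def model_ring_def by (rule diff_ideal_generated_ideal)
  have I_dderiv: "dderiv x \<in> I" if "x \<in> I" for x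
    using that unfolding I by (rule diff_ideal_generated_dderiv)
  have gen: "g \<in> I" if "g \<in> S" for g
    using that unfolding I by (rule diff_ideal_generated_gen)
  have state_R: "polys_in (state_vars N) \<subseteq> R"
    unfolding R_def model_ring_def
    by (rule subsetI, rule polys_in_mono) (auto simp: state_vars_def dvars_of_def)
  have var_R: "var W j \<in> R" for j
    by (simp add: R_def model_ring_def dvars_of_def)
  \<comment> \<open>Chain rule along the system: \<open>dderiv B\<close> is the coefficientwise
    derivative plus a combination of first derivatives of states, and \<open>Q\<close> times each of
    these is congruent to its numerator.\<close>
  have reduce: "\<exists>B'\<in>polys_in (state_vars N). Q * dderiv B - B' \<in> I"
    if B: "B \<in> polys_in (state_vars N)" for B
  proof -
    define ix where "ix v = (case indet_of v of U i \<Rightarrow> i | _ \<Rightarrow> 0)" for v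
    have v: "ix v \<in> {1..N} \<and> v = Deriv (U (ix v)) 0" if "v \<in> vars B" for v
      using that B by (auto simp: polys_in_def state_vars_def ix_def)
    let ?B = "Q * coeff_deriv B + (\<Sum>v\<in>vars B. partial_deriv v B * a (ix v))"
    have "Q * dderiv B - ?B = (\<Sum>v\<in>vars B.
        partial_deriv v B * (Q * var (indet_of v) (Suc (ord_of v)) - a (ix v)))"
      unfolding dderiv_def distrib_left sum_distrib_left right_diff_distrib sum_subtractf
      by (simp add: mult.left_commute)
    also have "\<dots> \<in> I"
    proof (intro I_sum I_mult gen)
      fix w assume w: "w \<in> vars B"
      show "partial_deriv w B \<in> R" using partial_deriv_in[OF B] state_R by blast
      have ix: "ix w \<in> {1..N}" and "w = Deriv (U (ix w)) 0" using v[OF w] by blast+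
      from arg_cong[OF this(2), of indet_of] arg_cong[OF this(2), of ord_of]
      have "Q * var (indet_of w) (Suc (ord_of w)) - a (ix w) = Q * var (U (ix w)) 1 - a (ix w)"
        by (simp only: dvar.sel One_nat_def)
      also have "\<dots> \<in> S" unfolding S_def by (rule insertI2, rule imageI, rule ix)
      finally show "Q * var (indet_of w) (Suc (ord_of w)) - a (ix w) \<in> S" .
    qed
    finally have "Q * dderiv B - ?B \<in> I" .
    moreover have "?B \<in> polys_in (state_vars N)"
      using v by (intro polys_in_add polys_in_mult Q coeff_deriv_in B polys_in_sum partial_deriv_in a)
        blast
    ultimately show ?thesis by blast
  qed
  have "\<forall>j. \<exists>k B. B \<in> polys_in (state_vars N) \<and> Q ^ k * var W j - B \<in> I"
  proof (rule allI)
    fix j show "\<exists>k B. B \<in> polys_in (state_vars N) \<and> Q ^ k * var W j - B \<in> I"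
    proof (induction j)
      case 0
      have "Q ^ 1 * var W 0 - b \<in> I" using gen[of "Q * var W 0 - b"] by (simp add: S_def)
      with b show ?case by blast
    next
      case (Suc j)
      then obtain k B where B: "B \<in> polys_in (state_vars N)" "Q ^ k * var W j - B \<in> I" by blast
      \<comment> \<open>The factor \<open>Q ^ k\<close> depends on the states too, so the derivative
        of \<open>Q\<close> has to be reduced as well.\<close>
      obtain Q' where Q': "Q' \<in> polys_in (state_vars N)" "Q * dderiv Q - Q' \<in> I"
        using reduce[OF Q] by blast
      obtain B' where B': "B' \<in> polys_in (state_vars N)" "Q * dderiv B - B' \<in> I"
        using reduce[OF B(1)] by blast
      have "dderiv Q \<in> R"
        using Q state_R unfolding R_def model_ring_def by (blast intro: dderiv_in)
      then have "Q ^ (k + 2) * dderiv (var W j) - (Q * B' - of_nat k * B * Q') \<in> I"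
        using B Q Q' B' state_R
        by (intro I_reduced_deriv[of dderiv] dderiv_add dderiv_mult I_dderiv) auto
      moreover have "Q * B' - of_nat k * B * Q' \<in> polys_in (state_vars N)"
        by (intro polys_in_diff polys_in_mult polys_in_of_nat Q Q' B B')
      ultimately show ?case unfolding dderiv_var by blast
    qed
  qed
  then obtain k B where B: "\<And>j. B j \<in> polys_in (state_vars N)"
    and red: "\<And>j. Q ^ k j * var W j - B j \<in> I"
    unfolding choice_iff by blast
  define X where "X = {Deriv W j | j. j \<le> N}"
  have X: "X = Deriv W ` {..N}" by (auto simp: X_def)
  have finX: "finite X" and cardX: "card (state_vars N) < card X"
    unfolding X by (auto simp: card_state_vars card_image inj_on_def)
  obtain d and P :: "'k dpoly" where P: "P \<in> polys_in X" "P \<noteq> 0" "degree_le d P"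
    and P0: "(\<Sum>t\<in>Poly_Mapping.keys P. const (Poly_Mapping.lookup P t) *
      (\<Prod>v\<in>X. (Q ^ k (ord_of v)) ^ (d - Poly_Mapping.lookup t v) *
        B (ord_of v) ^ Poly_Mapping.lookup t v)) = 0"
    by (rule algebraic_dependence[OF card_state_vars(1) finX cardX, of "\<lambda>v. Q ^ k (ord_of v)"
        "\<lambda>v. B (ord_of v)"]) (rule polys_in_power[OF Q] B | assumption)+
  have X_W: "X \<subseteq> dvars_of {W}" by (auto simp: X_def dvars_of_def)
  have W_R: "polys_in (dvars_of {W}) \<subseteq> R"
    unfolding R_def model_ring_def by (rule subsetI, rule polys_in_mono) (auto simp: dvars_of_def)
  have Q_R: "Q \<in> R" using Q state_R by blast
  \<comment> \<open>With this exponent, \<open>Q ^ K\<close> clears the denominators of all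
    monomials in \<open>X\<close> with exponents up to \<open>d\<close>.\<close>
  define K where "K = (\<Sum>v\<in>X. k (ord_of v) * d)"
  let ?H = "\<lambda>v. Q ^ k (ord_of v)" and ?w = "\<lambda>v. var W (ord_of v)"
  let ?c = "\<lambda>t. const (Poly_Mapping.lookup P t)"
  have QK: "Q ^ K = (\<Prod>v\<in>X. ?H v ^ d)"
    by (simp add: K_def power_sum power_mult)
  \<comment> \<open>Each occurrence of a derivative of w gets its own factor \<open>?H v\<close> and
    can then be replaced by \<open>B (ord_of v)\<close>. The degree bound on \<open>P\<close>
    guarantees that \<open>Q ^ K\<close> supplies enough factors.\<close>
  have monom: "Q ^ K * Poly_Mapping.single t (Poly_Mapping.lookup P t) = ?c t *
      (\<Prod>v\<in>X. ?H v ^ (d - Poly_Mapping.lookup t v) * (?H v * ?w v) ^ Poly_Mapping.lookup t v)"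
    if t: "t \<in> Poly_Mapping.keys P" for t
  proof -
    have "Poly_Mapping.keys t \<subseteq> X" using t P(1) by (auto simp: polys_in_def vars_def)
    moreover have "(\<Prod>v\<in>X. var (indet_of v) (ord_of v) ^ Poly_Mapping.lookup t v)
        = (\<Prod>v\<in>X. ?w v ^ Poly_Mapping.lookup t v :: 'k dpoly)"
      by (rule prod.cong) (auto simp: X_def)
    ultimately have "Q ^ K * Poly_Mapping.single t (Poly_Mapping.lookup P t)
        = ?c t * (\<Prod>v\<in>X. ?H v ^ d * ?w v ^ Poly_Mapping.lookup t v)"
      by (simp only: single_conv_prod[OF finX] QK prod.distrib mult.left_commute)
    also have "(\<Prod>v\<in>X. ?H v ^ d * ?w v ^ Poly_Mapping.lookup t v) = (\<Prod>v\<in>X.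
        ?H v ^ (d - Poly_Mapping.lookup t v) * (?H v * ?w v) ^ Poly_Mapping.lookup t v)"
    proof (rule prod.cong[OF refl])
      fix v
      have "Poly_Mapping.lookup t v \<le> d" using P(3) t by (simp add: degree_le_def)
      then have "?H v ^ d = ?H v ^ (d - Poly_Mapping.lookup t v) * ?H v ^ Poly_Mapping.lookup t v"
        by (simp only: power_add[symmetric] le_add_diff_inverse2)
      then show "?H v ^ d * ?w v ^ Poly_Mapping.lookup t v =
          ?H v ^ (d - Poly_Mapping.lookup t v) * (?H v * ?w v) ^ Poly_Mapping.lookup t v"
        by (simp only: power_mult_distrib mult.assoc)
    qed
    finally show ?thesis .
  qed
  have "Q ^ K * P = Q ^ K * (\<Sum>t\<in>Poly_Mapping.keys P.
      Poly_Mapping.single t (Poly_Mapping.lookup P t))"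
    by (rule arg_cong[OF poly_mapping_sum_single])
  also have "\<dots> = (\<Sum>t\<in>Poly_Mapping.keys P. ?c t * (\<Prod>v\<in>X.
      ?H v ^ (d - Poly_Mapping.lookup t v) * (?H v * ?w v) ^ Poly_Mapping.lookup t v))"
    unfolding sum_distrib_left by (rule sum.cong[OF refl monom])
  \<comment> \<open>Subtracting the relation \<open>P0\<close>, which is 0, leaves in each term a
    difference of two products that agree modulo \<open>I\<close> factor by factor.\<close>
  also have "\<dots> = (\<Sum>t\<in>Poly_Mapping.keys P. ?c t * ((\<Prod>v\<in>X.
      ?H v ^ (d - Poly_Mapping.lookup t v) * (?H v * ?w v) ^ Poly_Mapping.lookup t v)
      - (\<Prod>v\<in>X. ?H v ^ (d - Poly_Mapping.lookup t v) * B (ord_of v) ^ Poly_Mapping.lookup t v)))"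
    unfolding right_diff_distrib sum_subtractf P0 by (rule diff_0_right[symmetric])
  also have "\<dots> \<in> I"
  proof (intro I_sum I_mult I_prod_diff I_mult_diff I_power_diff red)
    have B_R: "B j \<in> R" for j using B state_R by blast
    have c_R: "const c \<in> R" for c by (simp add: R_def model_ring_def)
    show "x - x \<in> I" for x by (simp add: I_0)
    show "?c t \<in> R" for t by (rule c_R)
    show "Q \<in> R" by (rule Q_R)
    show "?H v \<in> R" "?H v ^ n \<in> R" "B (ord_of v) \<in> R" "B (ord_of v) ^ n \<in> R" "?H v * ?w v \<in> R"
        "?H v ^ n * (?H v * ?w v) ^ n' \<in> R" "?H v ^ n * B (ord_of v) ^ n' \<in> R" for v n n'
      by (intro R_mult R_power Q_R var_R B_R)+
  qed (simp_all only: R_power Q_R)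
  finally have QP: "Q ^ K * P \<in> I" .
  have P_W: "P \<in> polys_in (dvars_of {W})" by (rule polys_in_mono[OF X_W P(1)])
  then have P_R: "P \<in> R" using W_R by blast
  show thesis
  proof (cases "vars P = {}")
    case False
    show thesis
    proof (rule that[OF _ P_W P(2)])
      show "P \<in> saturation R I Q" using P_R QP by (auto simp: saturation_def)
      show "dorder W P \<le> N" using P(1) by (intro dorder_le False) (simp add: polys_in_def X_def)
    qed
  next
    \<comment> \<open>If \<open>P\<close> is a non-zero constant, then a power of \<open>Q\<close>
      lies in \<open>I\<close>, the saturation is all of \<open>R\<close>, and w itself is a
      suitable element.\<close>
    case True
    have P_const: "P = const (Poly_Mapping.lookup P 0)"
    proof (rule poly_mapping_eqI)
      fix t
      have "t \<notin> Poly_Mapping.keys P" if "t \<noteq> 0"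
        using that True by (auto simp: vars_def)
      then show "Poly_Mapping.lookup P t =
          Poly_Mapping.lookup (const (Poly_Mapping.lookup P 0)) t"
        by (cases "t = 0") (simp_all add: const_def lookup_single in_keys_iff)
    qed
    define c where "c = Poly_Mapping.lookup P 0"
    have "c \<noteq> 0"
      using P(2) arg_cong[of c 0 const] P_const by (auto simp: c_def)
    then have "const (inverse c) * P = 1"
      by (subst P_const) (simp add: const_def mult_single c_def)
    moreover have "const (inverse c) * (var W 0 * (Q ^ K * P)) \<in> I"
      by (intro I_mult var_R QP) (simp add: R_def model_ring_def)
    moreover have "const (inverse c) * (var W 0 * (Q ^ K * P)) =
        const (inverse c) * P * (Q ^ K * var W 0)"
      by (simp only: ac_simps)
    ultimately have "Q ^ K * var W 0 \<in> I" by simp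
    then have "var W 0 \<in> saturation R I Q" using var_R by (auto simp: saturation_def)
    moreover have "var W 0 \<in> polys_in (dvars_of {W})" by (simp add: dvars_of_def)
    moreover have "var W 0 \<noteq> (0 :: 'k dpoly)"
    proof
      assume "var W 0 = (0 :: 'k dpoly)"
      then have "vars (var W 0 :: 'k dpoly) = vars (0 :: 'k dpoly)" by (rule arg_cong)
      then show False by simp
    qed
    moreover have "dorder W (var W 0 :: 'k dpoly) \<le> N" by (rule dorder_le) auto
    ultimately show thesis by (rule that)
  qed
qed

text \<open>\<open>model_ideal\<close> picks its denominator by \<open>SOME\<close>. The given one
  shows that the picked one is a genuine common denominator, and the elimination is carried out with
  the latter.\<close>

lemma min_order_le_states:
  assumes "common_denominator M Q0 a0 b0"
  shows "min_order M \<le> enat (states M)"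
proof -
  define s where "s = (SOME (Q, a, b). common_denominator M Q a b)"
  obtain Q a b where s: "s = (Q, a, b)" by (cases s)
  have "case s of (Q, a, b) \<Rightarrow> common_denominator M Q a b"
    unfolding s_def by (rule someI[of _ "(Q0, a0, b0)"]) (use assms in simp)
  then have "common_denominator M Q a b" by (simp add: s)
  then obtain P where P: "P \<in> model_ideal M" "P \<in> polys_in (dvars_of {W})" "P \<noteq> 0"
    and order: "dorder W P \<le> states M"
    using model_elimination[of Q "states M" b a]
    unfolding model_ideal_def Let_def s_def[symmetric] s common_denominator_def prod.case by blast
  have "min_order M \<le> enat (dorder W P)"
    unfolding min_order_def by (rule INF_lower) (use P in simp)
  also have "\<dots> \<le> enat (states M)" using order by simp
  finally show ?thesis .
qed

section \<open>The model for the composition\<close>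

lemma rats_inI: "P \<in> polys_in V \<Longrightarrow> Q \<in> polys_in V \<Longrightarrow> Q \<noteq> 0 \<Longrightarrow> Fract P Q \<in> rats_in V"
  unfolding rats_in_def by blast

lemma rats_inE:
  assumes "r \<in> rats_in V"
  obtains P Q where "P \<in> polys_in V" "Q \<in> polys_in V" "Q \<noteq> 0" "r = Fract P Q"
  using assms unfolding rats_in_def by blast

lemma rats_in_to_fract: "P \<in> polys_in V \<Longrightarrow> to_fract P \<in> rats_in V"
  using rats_inI[of P V 1] by (simp add: to_fract_def)

lemma rats_in_0: "0 \<in> rats_in V"
  using rats_in_to_fract[OF polys_in_0] by simp

lemma rats_in_1: "1 \<in> rats_in V"
  using rats_in_to_fract[OF polys_in_1] by simp

lemma rats_in_add:
  assumes "r \<in> rats_in V" "s \<in> rats_in V"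
  shows "r + s \<in> rats_in V"
proof -
  obtain P Q where r: "P \<in> polys_in V" "Q \<in> polys_in V" "Q \<noteq> 0" "r = Fract P Q"
    using assms(1) by (rule rats_inE)
  obtain P' Q' where s: "P' \<in> polys_in V" "Q' \<in> polys_in V" "Q' \<noteq> 0" "s = Fract P' Q'"
    using assms(2) by (rule rats_inE)
  have "r + s = Fract (P * Q' + P' * Q) (Q * Q')"
    unfolding r(4) s(4) by (rule add_fract[OF r(3) s(3)])
  also have "\<dots> \<in> rats_in V"
    by (intro rats_inI polys_in_add polys_in_mult r s no_zero_divisors)
  finally show ?thesis .
qed

lemma rats_in_mult:
  assumes "r \<in> rats_in V" "s \<in> rats_in V"
  shows "r * s \<in> rats_in V"
proof -
  obtain P Q where r: "P \<in> polys_in V" "Q \<in> polys_in V" "Q \<noteq> 0" "r = Fract P Q"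
    using assms(1) by (rule rats_inE)
  obtain P' Q' where s: "P' \<in> polys_in V" "Q' \<in> polys_in V" "Q' \<noteq> 0" "s = Fract P' Q'"
    using assms(2) by (rule rats_inE)
  show ?thesis
    unfolding r(4) s(4) mult_fract by (intro rats_inI polys_in_mult r s no_zero_divisors)
qed

lemma rats_in_inverse:
  assumes "r \<in> rats_in V"
  shows "inverse r \<in> rats_in V"
proof (cases "r = 0")
  case True
  then show ?thesis by (simp only: inverse_zero rats_in_0)
next
  case False
  obtain P Q where r: "P \<in> polys_in V" "Q \<in> polys_in V" "Q \<noteq> 0" "r = Fract P Q"
    using assms by (rule rats_inE)
  then have "P \<noteq> 0" using False by (auto simp: fract_collapse)
  then show ?thesis unfolding r(4) inverse_fract by (intro rats_inI r)
qed

lemma rats_in_divide: "r \<in> rats_in V \<Longrightarrow> s \<in> rats_in V \<Longrightarrow> r / s \<in> rats_in V"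
  unfolding divide_inverse by (intro rats_in_mult rats_in_inverse)

lemma rats_in_power: "r \<in> rats_in V \<Longrightarrow> r ^ k \<in> rats_in V"
  by (induction k) (simp_all add: rats_in_1 rats_in_mult)

lemma rats_in_sum: "(\<And>a. a \<in> A \<Longrightarrow> f a \<in> rats_in V) \<Longrightarrow> sum f A \<in> rats_in V"
  by (induction A rule: infinite_finite_induct) (simp_all add: rats_in_0 rats_in_add)

lemma rats_in_prod: "(\<And>a. a \<in> A \<Longrightarrow> f a \<in> rats_in V) \<Longrightarrow> prod f A \<in> rats_in V"
  by (induction A rule: infinite_finite_induct) (simp_all add: rats_in_1 rats_in_mult)

text \<open>The default value 0 of \<open>hom_fract\<close> also lies in
  \<open>rats_in V\<close>.\<close>

lemma hom_fract_in:
  assumes "\<And>a. h a \<in> rats_in V"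
  shows "hom_fract h r \<in> rats_in V"
proof (cases "\<exists>a b. h b \<noteq> 0 \<and> r = Fract a b")
  case True
  then have "\<exists>c a b. h b \<noteq> 0 \<and> r = Fract a b \<and> c = h a / h b" by blast
  from someI_ex[OF this] obtain a b where "hom_fract h r = h a / h b"
    using True unfolding hom_fract_def by auto
  then show ?thesis by (simp only: rats_in_divide assms)
next
  case False
  then show ?thesis unfolding hom_fract_def by (simp only: if_False rats_in_0)
qed

lemma subst_vars_in:
  assumes "\<And>v. \<sigma> v \<in> rats_in V"
  shows "subst_vars \<sigma> r \<in> rats_in V"
  unfolding subst_vars_def
proof (rule hom_fract_in)
  show "subst_poly (\<lambda>c. to_fract (const c)) \<sigma> P \<in> rats_in V" for P
    unfolding subst_poly_def
    by (intro rats_in_sum rats_in_mult rats_in_prod rats_in_power rats_in_to_fract polys_in_const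
        assms)
qed

lemma rats_in_state: "1 \<le> i \<Longrightarrow> i \<le> N \<Longrightarrow> rvar (U i) 0 \<in> rats_in (state_vars N)"
  by (rule rats_in_to_fract) (simp add: state_vars_def)

text \<open>Every variable is sent to one of the states or to 0, whatever occurs in
  \<open>r\<close>.\<close>

lemma to_states_in: "to_states m n r \<in> rats_in (state_vars (m + n))"
  unfolding to_states_def
proof (rule subst_vars_in)
  show "(case v of
        Deriv Z j \<Rightarrow> if j < m then rvar (U (j + 1)) 0 else 0
      | Deriv W j \<Rightarrow> if j < n then rvar (U (m + 1 + j)) 0 else 0
      | _ \<Rightarrow> 0) \<in> rats_in (state_vars (m + n))" for v
    by (auto split: dvar.split indet.split intro!: rats_in_0 rats_in_state)
qed

lemma common_denominator_of_finite:
  assumes "finite A" "\<And>i. i \<in> A \<Longrightarrow> f i \<in> rats_in V"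
  shows "\<exists>Q\<in>polys_in V. Q \<noteq> 0 \<and> (\<forall>i\<in>A. \<exists>a\<in>polys_in V. f i = Fract a Q)"
  using assms
proof (induction A rule: finite_induct)
  case empty
  show ?case by (rule bexI[of _ 1]) simp_all
next
  case (insert x A)
  then obtain Q where Q: "Q \<in> polys_in V" "Q \<noteq> 0" "\<forall>i\<in>A. \<exists>a\<in>polys_in V. f i = Fract a Q"
    by auto
  have "f x \<in> rats_in V" using insert by simp
  then obtain P e where x: "P \<in> polys_in V" "e \<in> polys_in V" "e \<noteq> 0" "f x = Fract P e"
    by (rule rats_inE)
  show ?case
  proof (rule bexI[of _ "e * Q"], intro conjI ballI)
    show "e * Q \<noteq> 0" using x(3) Q(2) by (rule no_zero_divisors)
    show "e * Q \<in> polys_in V" using x(2) Q(1) by (rule polys_in_mult)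
    fix i assume "i \<in> insert x A"
    then show "\<exists>a\<in>polys_in V. f i = Fract a (e * Q)"
    proof
      assume "i = x"
      then have "f i = Fract (Q * P) (e * Q)"
        using mult_fract_cancel[OF Q(2), of P e] x(4) by (simp only: mult.commute)
      then show ?thesis using polys_in_mult[OF Q(1) x(1)] by blast
    next
      assume "i \<in> A"
      then obtain a where a: "a \<in> polys_in V" "f i = Fract a Q" using Q(3) by blast
      then have "f i = Fract (e * a) (e * Q)" by (simp only: mult_fract_cancel[OF x(3)])
      then show ?thesis using polys_in_mult[OF x(2) a(1)] by blast
    qed
  qed
qed

lemma common_denominator_exists:
  assumes "\<And>i. i \<in> {1..states M} \<Longrightarrow> rhs M i \<in> rats_in (state_vars (states M))"
    and "observed M \<in> rats_in (state_vars (states M))"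
  shows "\<exists>Q a b. common_denominator M Q a b"
proof -
  \<comment> \<open>States are numbered from 1, so index 0 is free for the output, and one
    denominator is obtained for all fractions together.\<close>
  define f where "f i = (if i = 0 then observed M else rhs M i)" for i
  have f: "f i \<in> rats_in (state_vars (states M))" if "i \<in> {0..states M}" for i
    using that assms by (simp add: f_def)
  obtain Q where Q: "Q \<in> polys_in (state_vars (states M))" "Q \<noteq> 0"
    and ex: "\<forall>i\<in>{0..states M}. \<exists>a\<in>polys_in (state_vars (states M)). f i = Fract a Q"
    using common_denominator_of_finite[of "{0..states M}" f, OF finite_atLeastAtMost f] by blast
  have "\<exists>a. \<forall>i\<in>{0..states M}. a i \<in> polys_in (state_vars (states M)) \<and> f i = Fract (a i) Q"
    using ex by (intro bchoice) (simp only: Bex_def)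
  then obtain a where
    "\<forall>i\<in>{0..states M}. a i \<in> polys_in (state_vars (states M)) \<and> f i = Fract (a i) Q" ..
  then have a: "a i \<in> polys_in (state_vars (states M)) \<and> f i = Fract (a i) Q"
    if "i \<le> states M" for i
    using that by (elim bspec) simp
  have "rhs M i = Fract (a i) Q" if "i \<in> {1..states M}" for i
    using a[of i] that by (simp add: f_def)
  moreover have "observed M = Fract (a 0) Q" using a[of 0] by (simp add: f_def)
  ultimately have "common_denominator M Q a (a 0)"
    unfolding common_denominator_def using Q a by auto
  then show ?thesis by blast
qed

lemma composition_order_le: "composition_order p q \<le> enat (inner_order q + outer_order p)"
proof -
  let ?M = "composition_model p q"
  have states: "states ?M = inner_order q + outer_order p"
    by (simp add: composition_model_def Let_def)
  have "\<exists>Q a b. common_denominator ?M Q a b"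
  proof (rule common_denominator_exists)
    fix i assume "i \<in> {1..states ?M}"
    \<comment> \<open>The last index always falls into one of the first two branches, according to
      whether \<open>outer_order p\<close> is positive; so the shifted state in the third branch
      exists.\<close>
    then show "rhs ?M i \<in> rats_in (state_vars (states ?M))"
      unfolding states
      by (auto simp: composition_model_def Let_def to_states_in intro!: rats_in_state)
  next
    \<comment> \<open>For outer order 0 the output is \<open>rp\<close> rather than a state, which
      needs the instance of \<open>to_states_in\<close> with 0.\<close>
    show "observed ?M \<in> rats_in (state_vars (states ?M))"
      unfolding states
      by (auto simp: composition_model_def Let_def intro!: rats_in_state)
        (use to_states_in[of "inner_order q" 0] in simp)
  qed
  then show ?thesis
    unfolding composition_order_def using min_order_le_states[of ?M] by (auto simp: states)
qed

section \<open>The order of the form that is linear in its highest derivative\<close>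

lemma of_nat_ratfun_neq_0: "n \<noteq> 0 \<Longrightarrow> (of_nat n :: 'k::field_char_0 ratfun) \<noteq> 0"
proof -
  have "(of_nat n :: 'k ratfun) = to_fract (of_nat n)"
    by (simp add: of_nat_fract to_fract_def)
  then show "n \<noteq> 0 \<Longrightarrow> (of_nat n :: 'k ratfun) \<noteq> 0" by simp
qed

text \<open>Distinct terms containing \<open>v\<close> stay distinct when the exponent of
  \<open>v\<close> is lowered by one, so nothing cancels, and the factor from the exponent is
  non-zero in characteristic 0.\<close>

lemma partial_deriv_neq_0:
  assumes "v \<in> vars P"
  shows "partial_deriv v P \<noteq> 0"
proof -
  let ?e = "Poly_Mapping.single v (1::nat)"
  obtain s where s: "s \<in> Poly_Mapping.keys P" and v: "v \<in> Poly_Mapping.keys s"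
    using assms by (auto simp: vars_def)
  \<comment> \<open>Under truncated subtraction a term without \<open>v\<close> can collide with one
    in which \<open>v\<close> has exponent 1; such a term carries the coefficient 0.\<close>
  have inj: "t = s" if "Poly_Mapping.lookup t v \<noteq> 0" "t - ?e = s - ?e" for t
  proof (rule poly_mapping_eqI)
    fix u
    have "Poly_Mapping.lookup t u - Poly_Mapping.lookup ?e u
        = Poly_Mapping.lookup s u - Poly_Mapping.lookup ?e u"
      using arg_cong[OF that(2), of "\<lambda>r. Poly_Mapping.lookup r u"] by (simp only: lookup_minus)
    then show "Poly_Mapping.lookup t u = Poly_Mapping.lookup s u"
      using that(1) v by (cases "u = v") (simp_all add: lookup_single in_keys_iff)
  qed
  have "Poly_Mapping.lookup (partial_deriv v P) (s - ?e) = (\<Sum>t\<in>Poly_Mapping.keys P.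
      if t = s then of_nat (Poly_Mapping.lookup s v) * Poly_Mapping.lookup P s else 0)"
    unfolding partial_deriv_def lookup_sum
  proof (rule sum.cong[OF refl])
    fix t
    show "Poly_Mapping.lookup (Poly_Mapping.single (t - ?e)
        (of_nat (Poly_Mapping.lookup t v) * Poly_Mapping.lookup P t)) (s - ?e) =
        (if t = s then of_nat (Poly_Mapping.lookup s v) * Poly_Mapping.lookup P s else 0)"
    proof (cases "Poly_Mapping.lookup t v = 0")
      case True
      then have "t \<noteq> s" using v by (auto simp: in_keys_iff)
      with True show ?thesis by simp
    next
      case False
      then have "t - ?e = s - ?e \<longleftrightarrow> t = s" using inj by blast
      then show ?thesis unfolding lookup_single when_def by simp
    qed
  qed
  also have "\<dots> = of_nat (Poly_Mapping.lookup s v) * Poly_Mapping.lookup P s"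
    using s by (simp add: sum.delta)
  also have "\<dots> \<noteq> 0"
    using s v by (intro no_zero_divisors of_nat_ratfun_neq_0) (simp_all add: in_keys_iff)
  finally show ?thesis by (metis lookup_zero)
qed

text \<open>With \<open>v' = Deriv X (Suc j)\<close> for \<open>v = Deriv X j\<close>, the partial derivative by \<open>v'\<close> and the
  derivation have the partial derivative by \<open>v\<close> as their commutator.\<close>

lemma partial_deriv_dderiv:
  assumes "Deriv X (Suc j) \<notin> vars P"
  shows "partial_deriv (Deriv X (Suc j)) (dderiv P) = partial_deriv (Deriv X j) P"
proof -
  let ?v = "Deriv X j" and ?v' = "Deriv X (Suc j)"
  have in_vars: "P \<in> polys_in (vars P)" by (simp add: polys_in_def)
  have 0: "partial_deriv ?v' R = 0" if "R \<in> polys_in (vars P)" for R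
    using that assms by (intro partial_deriv_eq_0) (auto simp: polys_in_def)
  have var: "partial_deriv ?v' (var (indet_of u) (Suc (ord_of u)) :: 'a dpoly) = (if u = ?v then 1 else 0)"
    for u
  proof (cases "u = ?v")
    case True
    then show ?thesis unfolding True var_def partial_deriv_single by simp
  next
    case False
    then have "Deriv (indet_of u) (Suc (ord_of u)) \<noteq> ?v'" by (cases u) auto
    then have "?v' \<notin> vars (var (indet_of u) (Suc (ord_of u)) :: 'a dpoly)" by auto
    from partial_deriv_eq_0[OF this] False show ?thesis by (simp only: if_False)
  qed
  have "partial_deriv ?v' (dderiv P) =
      (\<Sum>u\<in>vars P. partial_deriv u P * partial_deriv ?v' (var (indet_of u) (Suc (ord_of u))))"
    unfolding dderiv_def partial_deriv_add
      additive_sum[where D = "partial_deriv ?v'", OF partial_deriv_add] partial_deriv_mult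
    by (simp only: 0 coeff_deriv_in partial_deriv_in in_vars mult_zero_left add_0_left)
  also have "\<dots> = (\<Sum>u\<in>vars P. if u = ?v then partial_deriv ?v P else 0)"
    by (rule sum.cong) (simp_all add: var)
  also have "\<dots> = partial_deriv ?v P"
    by (simp add: sum.delta partial_deriv_eq_0)
  finally show ?thesis .
qed

text \<open>Differentiation raises the index of a variable by at most one. The less obvious half is
  that some variable occurs in \<open>dderiv P\<close>, so that its order is meaningful.\<close>

lemma dorder_lho_form_le:
  assumes "P \<in> polys_in (dvars_of {X})" "vars P \<noteq> {}"
  shows "dorder X (lho_form X P) \<le> dorder X P + 1"
proof (cases "lho X P")
  case True
  then show ?thesis by (simp add: lho_form_def)
next
  case False
  define n where "n = dorder X P"
  let ?J = "{j. Deriv X j \<in> vars P}"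
  have "?J \<subseteq> ord_of ` vars P" by force
  then have fin: "finite ?J" by (rule finite_subset) simp
  have vars: "\<exists>j. v = Deriv X j" if "v \<in> vars P" for v
    using that assms(1) by (auto simp: polys_in_def dvars_of_def)
  with assms(2) have "?J \<noteq> {}" by blast
  then have top: "Deriv X n \<in> vars P" using Max_in[OF fin] by (simp add: n_def dorder_def)
  have le: "j \<le> n" if "Deriv X j \<in> vars P" for j
    using that Max_ge[OF fin] by (simp add: n_def dorder_def)
  let ?V = "{Deriv X j | j. j \<le> n + 1}"
  have sub: "vars P \<subseteq> ?V" using vars le by fastforce
  have "dderiv P \<in> polys_in ?V"
    unfolding dderiv_def
  proof (intro polys_in_add coeff_deriv_in polys_in_sum polys_in_mult partial_deriv_in)
    show "P \<in> polys_in ?V" using sub by (simp add: polys_in_def)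
    fix v assume v: "v \<in> vars P"
    then obtain j where "v = Deriv X j" using vars by blast
    with v le show "var (indet_of v) (Suc (ord_of v)) \<in> polys_in ?V" by auto
    show "P \<in> polys_in ?V" using sub by (simp add: polys_in_def)
  qed
  \<comment> \<open>The coefficient of \<open>Deriv X (Suc n)\<close> in the derivative is the
    separant, that is, the partial derivative of \<open>P\<close> by its highest variable, which is
    non-zero.\<close>
  moreover have "vars (dderiv P) \<noteq> {}"
  proof -
    have "Deriv X (Suc n) \<notin> vars P" using le[of "Suc n"] by auto
    then have "partial_deriv (Deriv X (Suc n)) (dderiv P) \<noteq> 0"
      using partial_deriv_neq_0[OF top] by (subst partial_deriv_dderiv)
    then show ?thesis using partial_deriv_eq_0 by blast
  qed
  ultimately have "dorder X (dderiv P) \<le> n + 1"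
    by (intro dorder_le) (simp_all add: polys_in_def)
  then show ?thesis using False by (simp add: lho_form_def n_def)
qed

theorem corollary4p13:
  fixes F :: "'k::field_char_0 ratfun set"
    and p q :: "'k dpoly"
    and m n :: nat
  assumes "F = range to_fract \<or> F = UNIV"
    and "p \<in> dpolys_over F {Y}" and "vars p \<noteq> {}" and "dorder Y p = n"
    and "q \<in> dpolys_over F {Z}" and "vars q \<noteq> {}" and "dorder Z q = m"
    and "composition_admissible p q"
  shows "composition_order p q \<le> enat (m + n + 2)"
proof -
  have "outer_order p \<le> n + 1"
    using dorder_lho_form_le[of p Y] assms(2-4) by (simp add: outer_order_def dpolys_over_def)
  moreover have "inner_order q \<le> m + 1"
    using dorder_lho_form_le[of q Z] assms(5-7) by (simp add: inner_order_def dpolys_over_def)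
  ultimately have "enat (inner_order q + outer_order p) \<le> enat (m + n + 2)" by simp
  with composition_order_le[of p q] show ?thesis by (rule order_trans)
qed

end
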